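(* The following decision problem (CORE-NONEMPTY without transferable utility, with $V(A)$ explicitly provided) is in $\mathcal{P}$. Input: a superadditive game in characteristic form without transferable utility, given by its concise representation $(A, W)$ together with an explicit (possibly redundant) list of all elements of the grand coalition's utility possibility set $V(A)$. Question: is the core of the game nonempty?
   Context: A coalition is a nonempty subset of the finite player set $A$; $A$ itself is the grand coalition. A concise representation of a game in characteristic form without transferable utility consists of $A$ and a finite set $W$ of pairs $(B, u^{B})$, where $B$ is a coalition and $u^{B} = (u^{B}_b)_{b\in B}$ is a vector of utilities indexed by the members of $B$ (there may be several pairs with the same $B$). It is required that $(\{a\},(0)) \in W$ for every $a\in A$. For a coalition $B$, the set of vectors derived from $W$ is $$D(B) = \{ (u^{B_1},\ldots,u^{B_r}) : r\ge 1,\ B_1,\ldots,B_r \text{ pairwise disjoint coalitions},\ \textstyle\bigcup_{i} B_i = B,\ (B_i,u^{B_i})\in W \text{ for all } i\},$$ where $(u^{B_1},\ldots,u^{B_r})$ denotes the vector indexed by $B$ obtained by concatenation. The utility possibility set of a coalition $B\ne A$ is $V(B)=D(B)$. The utility possibility set $V(A)$ is given in the input as a finite explicit list of vectors; since the game is superadditive (for all disjoint coalitions $B, C$ and all $u^B\in V(B)$, $u^C\in V(C)$, one has $(u^B,u^C)\in V(B\cup C)$), the input is promised to satisfy $D(A)\subseteq V(A)$ (the case $V(A)=D(A)$ being the one in which the list adds no new possibilities beyond those derivable from $W$). An outcome is an element $u^A\in V(A)$. It is blocked by a coalition $B\subseteq A$ if there is $u^B\in V(B)$ with $u^B_b > u^A_b$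 for all $b\in B$. The core is the set of outcomes blocked by no coalition. All utilities in the input are rational numbers encoded in binary, and the input size is the length of the encoding of $(A,W,V(A))$. Membership in $\mathcal{P}$ means that a polynomial-time algorithm answers correctly on every input satisfying the stated requirements. *)

theory Defs
  imports "HOL-Computational_Algebra.Polynomial"
begin

section \<open>Games without transferable utility\<close>

text \<open>A vector indexed by a coalition \<open>B\<close> is a partial function with domain \<open>B\<close>; concatenation of
  vectors over disjoint coalitions is \<open>(++)\<close>.\<close>

type_synonym 'a vector = "'a \<rightharpoonup> rat"

definition coalition :: "'a set \<Rightarrow> 'a set \<Rightarrow> bool" where
  "coalition A B \<longleftrightarrow> B \<noteq> {} \<and> B \<subseteq> A"

definition derived :: "('a set \<times> 'a vector) set \<Rightarrow> 'a set \<Rightarrow> 'a vector set" where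
  "derived W B =
     {foldr (++) (map snd ps) Map.empty | ps.
        ps \<noteq> [] \<and> set ps \<subseteq> W \<and>
        sorted_wrt (\<lambda>p q. fst p \<inter> fst q = {}) ps \<and>
        \<Union> (fst ` set ps) = B}"

text \<open>The set \<open>V(A)\<close> of the grand coalition is a separate component \<open>VA\<close> of a game.\<close>

definition possibility_set ::
  "'a set \<Rightarrow> ('a set \<times> 'a vector) set \<Rightarrow> 'a vector set \<Rightarrow> 'a set \<Rightarrow> 'a vector set" where
  "possibility_set A W VA B = (if B = A then VA else derived W B)"

definition superadditive :: "'a set \<Rightarrow> ('a set \<Rightarrow> 'a vector set) \<Rightarrow> bool" where
  "superadditive A V \<longleftrightarrow>
     (\<forall>B C. coalition A B \<and> coalition A C \<and> B \<inter> C = {} \<longrightarrow>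
        (\<forall>u\<in>V B. \<forall>v\<in>V C. u ++ v \<in> V (B \<union> C)))"

definition concise_representation :: "'a set \<Rightarrow> ('a set \<times> 'a vector) set \<Rightarrow> bool" where
  "concise_representation A W \<longleftrightarrow>
     finite A \<and> A \<noteq> {} \<and> finite W \<and>
     (\<forall>(B, u)\<in>W. coalition A B \<and> dom u = B) \<and>
     (\<forall>a\<in>A. ({a}, [a \<mapsto> 0]) \<in> W)"

text \<open>Superadditivity does not imply \<open>derived W A \<subseteq> VA\<close>, because a pair \<open>(A, u) \<in> W\<close> derives \<open>u\<close>
  without joining two disjoint coalitions. The converse implication holds.\<close>

definition valid_game :: "'a set \<Rightarrow> ('a set \<times> 'a vector) set \<Rightarrow> 'a vector set \<Rightarrow> bool" where
  "valid_game A W VA \<longleftrightarrow>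
     concise_representation A W \<and>
     finite VA \<and> (\<forall>u\<in>VA. dom u = A) \<and>
     superadditive A (possibility_set A W VA) \<and>
     derived W A \<subseteq> VA"

definition blocks :: "('a set \<Rightarrow> 'a vector set) \<Rightarrow> 'a set \<Rightarrow> 'a vector \<Rightarrow> bool" where
  "blocks V B u \<longleftrightarrow> (\<exists>w\<in>V B. \<forall>b\<in>B. the (w b) > the (u b))"

definition core :: "'a set \<Rightarrow> ('a set \<Rightarrow> 'a vector set) \<Rightarrow> 'a vector set" where
  "core A V = {u \<in> V A. \<not> (\<exists>B. coalition A B \<and> blocks V B u)}"


section \<open>Encoding of the input\<close>

text \<open>Players are named by natural numbers. An input lists the players, the pairs in \<open>W\<close> and the
  vectors in \<open>V(A)\<close>. A pair \<open>(B, u)\<close> is listed as the entries \<open>(b, u b)\<close> for \<open>b \<in> B\<close>, in any order.\<close>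

type_synonym listing = "(nat \<times> rat) list"
type_synonym game_input = "nat list \<times> listing list \<times> listing list"

definition input_players :: "game_input \<Rightarrow> nat set" where
  "input_players = (\<lambda>(as, ws, vs). set as)"

definition input_pairs :: "game_input \<Rightarrow> (nat set \<times> nat vector) set" where
  "input_pairs = (\<lambda>(as, ws, vs). (\<lambda>w. (fst ` set w, map_of w)) ` set ws)"

definition input_outcomes :: "game_input \<Rightarrow> nat vector set" where
  "input_outcomes = (\<lambda>(as, ws, vs). map_of ` set vs)"

definition valid_input :: "game_input \<Rightarrow> bool" where
  "valid_input = (\<lambda>(as, ws, vs).
     (\<forall>w \<in> set ws \<union> set vs. distinct (map fst w)) \<and>
     valid_game (input_players (as, ws, vs)) (input_pairs (as, ws, vs))
       (input_outcomes (as, ws, vs)))"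

definition input_core :: "game_input \<Rightarrow> nat vector set" where
  "input_core I =
     core (input_players I)
       (possibility_set (input_players I) (input_pairs I) (input_outcomes I))"

datatype letter = Digit bool | Minus | Slash | Colon | Comma | Semicolon | Bar

fun letter_code :: "letter \<Rightarrow> bool list" where
  "letter_code (Digit b) = [False, False, b]"
| "letter_code Minus     = [False, True, False]"
| "letter_code Slash     = [False, True, True]"
| "letter_code Colon     = [True, False, False]"
| "letter_code Comma     = [True, False, True]"
| "letter_code Semicolon = [True, True, False]"
| "letter_code Bar       = [True, True, True]"

text \<open>Binary notation, most significant digit first.\<close>

fun write_nat :: "nat \<Rightarrow> letter list" where
  "write_nat n =
     (if n < 2 then [Digit (n = 1)] else write_nat (n div 2) @ [Digit (odd n)])"

definition write_int :: "int \<Rightarrow> letter list" where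
  "write_int i = (if i < 0 then [Minus] else []) @ write_nat (nat \<bar>i\<bar>)"

definition write_rat :: "rat \<Rightarrow> letter list" where
  "write_rat r =
     (case quotient_of r of (p, q) \<Rightarrow> write_int p @ [Slash] @ write_nat (nat q))"

definition write_listing :: "listing \<Rightarrow> letter list" where
  "write_listing w =
     concat (map (\<lambda>(b, r). write_nat b @ [Colon] @ write_rat r @ [Comma]) w) @ [Semicolon]"

definition write_input :: "game_input \<Rightarrow> letter list" where
  "write_input = (\<lambda>(as, ws, vs).
     concat (map (\<lambda>a. write_nat a @ [Comma]) as) @ [Bar] @
     concat (map write_listing ws) @ [Bar] @
     concat (map write_listing vs))"

definition encode :: "game_input \<Rightarrow> bool list" where
  "encode I = concat (map letter_code (write_input I))"


section \<open>Polynomial time\<close>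

text \<open>Deterministic Turing machines with any fixed number of two-way infinite tapes. The input
  starts at cell 0 of the first tape, where its head is; every other cell of every tape is blank.
  States are taken from the natural numbers and auxiliary tape symbols are numbered; a machine uses
  finitely many of each.\<close>

datatype symbol = Blank | Bit bool | Aux nat
datatype move = Left | Stay | Right

record machine =
  tape_count :: nat
  states :: "nat set"
  alphabet :: "symbol set"
  start :: nat
  accept :: nat
  reject :: nat
  trans :: "nat \<Rightarrow> symbol list \<Rightarrow> nat \<times> (symbol \<times> move) list"

text \<open>The values of \<open>trans\<close> that matter form a finite table, by the finiteness and closure
  conditions below.\<close>

definition turing_machine :: "machine \<Rightarrow> bool" where
  "turing_machine M \<longleftrightarrow>
     tape_count M \<ge> 1 \<and> finite (states M) \<and> finite (alphabet M) \<and>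
     {Blank, Bit False, Bit True} \<subseteq> alphabet M \<and>
     {start M, accept M, reject M} \<subseteq> states M \<and> accept M \<noteq> reject M \<and>
     (\<forall>q\<in>states M. \<forall>ss. length ss = tape_count M \<and> set ss \<subseteq> alphabet M \<longrightarrow>
        (case trans M q ss of (q', acts) \<Rightarrow>
           q' \<in> states M \<and> length acts = tape_count M \<and> fst ` set acts \<subseteq> alphabet M))"

type_synonym tape = "(int \<Rightarrow> symbol) \<times> int"
type_synonym config = "nat \<times> tape list"

fun scanned :: "tape \<Rightarrow> symbol" where
  "scanned (cells, pos) = cells pos"

fun shift :: "move \<Rightarrow> int \<Rightarrow> int" where
  "shift Left pos = pos - 1"
| "shift Stay pos = pos"
| "shift Right pos = pos + 1"

fun act :: "symbol \<times> move \<Rightarrow> tape \<Rightarrow> tape" where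
  "act (s, m) (cells, pos) = (cells(pos := s), shift m pos)"

definition step :: "machine \<Rightarrow> config \<Rightarrow> config" where
  "step M = (\<lambda>(q, ts).
     if q = accept M \<or> q = reject M then (q, ts)
     else case trans M q (map scanned ts) of (q', acts) \<Rightarrow> (q', map2 act acts ts))"

definition input_tape :: "bool list \<Rightarrow> tape" where
  "input_tape x =
     (\<lambda>i. if 0 \<le> i \<and> i < int (length x) then Bit (x ! nat i) else Blank, 0)"

definition initial :: "machine \<Rightarrow> bool list \<Rightarrow> config" where
  "initial M x = (start M, input_tape x # replicate (tape_count M - 1) (\<lambda>_. Blank, 0))"

definition state_after :: "machine \<Rightarrow> bool list \<Rightarrow> nat \<Rightarrow> nat" where
  "state_after M x t = fst ((step M ^^ t) (initial M x))"

text \<open>A decision problem with a promise is the pair of its yes-instances and its no-instances; the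
  strings in neither violate the promise. A machine must halt in polynomial time on every string,
  and answer correctly where the promise holds.\<close>

type_synonym promise_problem = "bool list set \<times> bool list set"

definition class_P :: "promise_problem set" where
  "class_P = {(yes, no). \<exists>M (p :: nat poly).
     turing_machine M \<and>
     (\<forall>x. state_after M x (poly p (length x)) \<in> {accept M, reject M}) \<and>
     (\<forall>x\<in>yes. state_after M x (poly p (length x)) = accept M) \<and>
     (\<forall>x\<in>no. state_after M x (poly p (length x)) = reject M)}"

definition core_nonempty_problem :: promise_problem where
  "core_nonempty_problem =
     ({encode I | I. valid_input I \<and> input_core I \<noteq> {}},
      {encode I | I. valid_input I \<and> input_core I = {}})"

end

theory Submission
  imports Defs
begin

text \<open>An outcome is blocked iff it is blocked by a single pair of \<open>W\<close> or by a vector of \<open>V(A)\<close>: a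
  blocking vector that is concatenated from several pairs blocks already with each of them. So the
  core is nonempty iff some listed outcome \<open>u\<close> has, for each listed pair or outcome \<open>w\<close>, a player
  \<open>b\<close> with \<open>w b \<le> u b\<close>. This is decided by four nested loops over the text of the input, whose body
  compares two fractions by cross multiplication. The loops are written as a structured program on
  stacks, which a Turing machine simulates step by step with one tape per stack. All loops work
  on arbitrary letter sequences, so the polynomial time bound needs no syntax check.\<close>

section \<open>Programs on stacks\<close>

text \<open>Coalitions and derived vectors can be exponentially many, so the definition of the core
  cannot be evaluated directly; the listed vectors suffice because a concatenation agrees with each
  of its blocks on that block. The vectors of V(A) are tested besides those of W, since V(A) may
  contain vectors that W does not derive. Conversely, a pair \<open>(A, u)\<close> of W yields a
  blocking vector of \<open>A\<close> because \<open>derived W A \<subseteq> VA\<close>.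
  \<open>class_P\<close> asks for the state of a Turing machine at one fixed time, on every string.
  Hence \<open>exec\<close> counts steps exactly, the machine rests once it has answered, and all
  programs are specified on arbitrary letter sequences. Stacks reverse what is moved, and this is
  exploited: a copied number has its least significant digit on top, as addition and comparison
  require, and the input read from its end yields the outcomes first. The price is an empty segment
  in each nonempty reversed listing, which \<open>le_entry\<close> has to reject.\<close>

type_synonym store = "nat \<Rightarrow> letter list"
type_synonym view = "nat \<Rightarrow> letter option"

definition top_of :: "letter list \<Rightarrow> letter option" where
  "top_of xs = (case xs of [] \<Rightarrow> None | c # _ \<Rightarrow> Some c)"

lemma top_of_simps [simp]: "top_of [] = None" "top_of (c # xs) = Some c"
  by (simp_all add: top_of_def)

lemma top_of_eq_None [simp]: "top_of xs = None \<longleftrightarrow> xs = []" "None = top_of xs \<longleftrightarrow> xs = []"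
  by (cases xs; simp)+

definition tops :: "store \<Rightarrow> view" where
  "tops \<sigma> = (\<lambda>i. top_of (\<sigma> i))"

lemma tops_apply [simp]: "tops \<sigma> i = top_of (\<sigma> i)"
  by (simp add: tops_def)

text \<open>Tests and pushed letters are arbitrary functions of the top letters. This is faithful
  because a transition of a machine may depend in any way on the symbols under all its
  heads.\<close>

datatype prog =
    Skip
  | Push nat "view \<Rightarrow> letter"
  | Pop nat
  | Seq prog prog (infixr ";;" 60)
  | Cond "view \<Rightarrow> bool" prog prog
  | Loop "view \<Rightarrow> bool" prog

text \<open>The third argument is the exact number of machine steps of the compiled program.\<close>

inductive exec :: "prog \<Rightarrow> store \<Rightarrow> nat \<Rightarrow> store \<Rightarrow> bool" where
  exec_Skip: "exec Skip \<sigma> 1 \<sigma>"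
| exec_Push: "exec (Push i f) \<sigma> 2 (\<sigma>(i := f (tops \<sigma>) # \<sigma> i))"
| exec_Pop: "exec (Pop i) \<sigma> 1 (\<sigma>(i := tl (\<sigma> i)))"
| exec_Seq: "exec p \<sigma> t \<tau> \<Longrightarrow> exec q \<tau> s \<upsilon> \<Longrightarrow> exec (p ;; q) \<sigma> (Suc (t + s)) \<upsilon>"
| exec_Cond: "exec (if c (tops \<sigma>) then p else q) \<sigma> t \<tau> \<Longrightarrow> exec (Cond c p q) \<sigma> (Suc t) \<tau>"
| exec_Loop_stop: "\<not> c (tops \<sigma>) \<Longrightarrow> exec (Loop c p) \<sigma> 1 \<sigma>"
| exec_Loop_step: "c (tops \<sigma>) \<Longrightarrow> exec p \<sigma> t \<tau> \<Longrightarrow> exec (Loop c p) \<tau> s \<upsilon> \<Longrightarrow>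
    exec (Loop c p) \<sigma> (Suc (t + s)) \<upsilon>"

text \<open>Only a push can make a stack nonempty. With this bound the stacks from \<open>k\<close>
  on stay empty and get no tape: a pop there changes nothing and a test sees
  \<open>None\<close>.\<close>

primrec pushes_below :: "nat \<Rightarrow> prog \<Rightarrow> bool" where
  "pushes_below k Skip \<longleftrightarrow> True"
| "pushes_below k (Push i f) \<longleftrightarrow> i < k"
| "pushes_below k (Pop i) \<longleftrightarrow> True"
| "pushes_below k (p ;; q) \<longleftrightarrow> pushes_below k p \<and> pushes_below k q"
| "pushes_below k (Cond c p q) \<longleftrightarrow> pushes_below k p \<and> pushes_below k q"
| "pushes_below k (Loop c p) \<longleftrightarrow> pushes_below k p"

section \<open>Compilation to Turing machines\<close>

text \<open>A \<open>Digit\<close> is written as a \<open>Bit\<close>, so the input tape already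
  represents the stack \<open>map Digit x\<close>.\<close>

fun symbol_of :: "letter \<Rightarrow> symbol" where
  "symbol_of (Digit b) = Bit b"
| "symbol_of Minus = Aux 0"
| "symbol_of Slash = Aux 1"
| "symbol_of Colon = Aux 2"
| "symbol_of Comma = Aux 3"
| "symbol_of Semicolon = Aux 4"
| "symbol_of Bar = Aux 5"

lemma inj_sym: "inj symbol_of"
proof (rule injI)
  fix c d assume "symbol_of c = symbol_of d"
  then show "c = d" by (cases c; cases d; simp)
qed

lemma sym_not_Blank [simp]: "symbol_of c \<noteq> Blank"
  by (cases c) auto

lemma UNIV_letter:
  "(UNIV :: letter set) =
     {Digit True, Digit False, Minus, Slash, Colon, Comma, Semicolon, Bar}"
proof -
  have "c \<in> {Digit True, Digit False, Minus, Slash, Colon, Comma, Semicolon, Bar}" for c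
    by (cases c) auto
  then show ?thesis by blast
qed

instance letter :: finite
  by standard (simp add: UNIV_letter)

definition unsym :: "symbol \<Rightarrow> letter option" where
  "unsym s = (if s \<in> range symbol_of then Some (inv symbol_of s) else None)"

lemma unsym_sym [simp]: "unsym (symbol_of c) = Some c"
  by (simp add: unsym_def inj_sym)

lemma unsym_Blank [simp]: "unsym Blank = None"
proof -
  have "Blank \<notin> range symbol_of" using sym_not_Blank by (metis rangeE)
  then show ?thesis by (simp add: unsym_def)
qed

text \<open>A control state is the list of programs still to be run; the second component carries the
  letter of a push whose head has already moved.\<close>

type_synonym control = "prog list \<times> letter option"

text \<open>A transition writes before it moves, whereas a push has to move to the free cell on the
  left before it writes. Hence a push takes two steps, and its letter is fixed in the first, while
  the head still shows the old top.\<close>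

fun next_control :: "control \<Rightarrow> view \<Rightarrow> control" where
  "next_control ([], x) v = ([], None)"
| "next_control (Skip # K, x) v = (K, None)"
| "next_control (Push i f # K, None) v = (Push i f # K, Some (f v))"
| "next_control (Push i f # K, Some c) v = (K, None)"
| "next_control (Pop i # K, x) v = (K, None)"
| "next_control ((p ;; q) # K, x) v = (p # q # K, None)"
| "next_control (Cond c p q # K, x) v = ((if c v then p else q) # K, None)"
| "next_control (Loop c p # K, x) v = (if c v then p # Loop c p # K else K, None)"

fun head_action :: "control \<Rightarrow> nat \<Rightarrow> symbol \<Rightarrow> symbol \<times> move" where
  "head_action (Push i f # K, None) j s = (s, if i = j then Left else Stay)"
| "head_action (Push i f # K, Some c) j s = (if i = j then symbol_of c else s, Stay)"
| "head_action (Pop i # K, x) j s = (if i = j then (Blank, Right) else (s, Stay))"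
| "head_action _ j s = (s, Stay)"

text \<open>The lists that occur while \<open>p\<close> runs in front of a fixed rest
  \<open>K\<close>. A loop body always has the same list \<open>Loop c p # K\<close> behind it, so
  the set is finite although the number of rounds is unbounded.\<close>

primrec conts :: "prog \<Rightarrow> prog list \<Rightarrow> prog list set" where
  "conts Skip K = {Skip # K}"
| "conts (Push i f) K = {Push i f # K}"
| "conts (Pop i) K = {Pop i # K}"
| "conts (p ;; q) K = {(p ;; q) # K} \<union> conts p (q # K) \<union> conts q K"
| "conts (Cond c p q) K = {Cond c p q # K} \<union> conts p K \<union> conts q K"
| "conts (Loop c p) K = {Loop c p # K} \<union> conts p (Loop c p # K)"

section \<open>Finiteness and closure of the control states\<close>

lemma finite_conts: "finite (conts p K)"
  by (induction p arbitrary: K) auto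

lemma self_in_conts: "p # K \<in> conts p K"
  by (cases p) auto

lemma conts_closed:
  "L \<in> conts p K \<Longrightarrow> fst (next_control (L, x) v) \<in> insert K (conts p K)"
proof (induction p arbitrary: K)
  case (Push i f)
  then show ?case by (cases x) auto
next
  case (Seq p q)
  then show ?case using self_in_conts[of p "q # K"] self_in_conts[of q K] by fastforce
next
  case (Cond c p q)
  then consider "L = Cond c p q # K" | "L \<in> conts p K" | "L \<in> conts q K" by auto
  then show ?case
    using Cond.IH self_in_conts[of p K] self_in_conts[of q K] by cases auto
next
  case (Loop c p)
  then show ?case using self_in_conts[of p "Loop c p # K"] by fastforce
qed auto

definition controls :: "prog \<Rightarrow> control set" where
  "controls p = insert [] (conts p []) \<times> UNIV"

lemma finite_controls: "finite (controls p)"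
  by (simp add: controls_def finite_conts)

lemma controls_closed:
  assumes "s \<in> controls p"
  shows "next_control s v \<in> controls p"
proof (cases s)
  case (Pair L x)
  then have "L = [] \<or> L \<in> conts p []" using assms by (auto simp: controls_def)
  then have "fst (next_control (L, x) v) \<in> insert [] (conts p [])"
    using conts_closed[of L p "[]"] by auto
  then show ?thesis by (simp add: Pair controls_def mem_Times_iff)
qed

definition view_of :: "symbol list \<Rightarrow> view" where
  "view_of ss = (\<lambda>i. if i < length ss then unsym (ss ! i) else None)"

text \<open>Controls are numbered by \<open>num\<close> and shifted by 2, because 0 and 1 are the
  accepting and the rejecting state. At the empty list one further transition reads the answer off
  the tops of the stacks.\<close>

definition compile :: "nat \<Rightarrow> (view \<Rightarrow> bool) \<Rightarrow> prog \<Rightarrow> (control \<Rightarrow> nat) \<Rightarrow> machine" where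
  "compile k verdict p num =
     \<lparr>tape_count = k,
      states = {0, 1} \<union> (\<lambda>s. num s + 2) ` controls p,
      alphabet = insert Blank (range symbol_of),
      start = num ([p], None) + 2,
      accept = 0,
      reject = 1,
      trans = (\<lambda>q ss.
        if q < 2 then (q, map (\<lambda>s. (s, Stay)) ss)
        else let s = inv_into (controls p) num (q - 2); v = view_of ss in
          if fst s = [] then (if verdict v then 0 else 1, map (\<lambda>s. (s, Stay)) ss)
          else (num (next_control s v) + 2,
                map (\<lambda>i. head_action s i (ss ! i)) [0..<length ss]))\<rparr>"

lemma head_action_alphabet:
  "a \<in> insert Blank (range symbol_of) \<Longrightarrow> fst (head_action s i a) \<in> insert Blank (range symbol_of)"
  by (induction s i a rule: head_action.induct) auto

lemma turing_machine_compile: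
  assumes "k \<ge> 1" and inj: "inj_on num (controls p)"
  shows "turing_machine (compile k verdict p num)" (is "turing_machine ?M")
proof -
  have start: "([p], None) \<in> controls p"
    using self_in_conts[of p "[]"] by (simp add: controls_def)
  have bits: "{Blank, Bit False, Bit True} \<subseteq> insert Blank (range symbol_of)"
    by (metis insert_iff insert_subset rangeI symbol_of.simps(1) subsetI empty_iff)
  have "case trans ?M q ss of (q', acts) \<Rightarrow>
      q' \<in> states ?M \<and> length acts = tape_count ?M \<and> fst ` set acts \<subseteq> alphabet ?M"
    if q: "q \<in> states ?M" and ss: "length ss = tape_count ?M \<and> set ss \<subseteq> alphabet ?M" for q ss
  proof (cases "q < 2")
    case True
    then show ?thesis using q ss by (auto simp: compile_def)
  next
    case False
    then obtain s where s: "s \<in> controls p" "q = num s + 2"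
      using q by (auto simp: compile_def)
    have inv: "inv_into (controls p) num (q - 2) = s"
      using s inj by simp
    show ?thesis
    proof (cases "fst s = []")
      case True
      then show ?thesis using False inv ss by (auto simp: compile_def Let_def)
    next
      case ne: False
      have "next_control s (view_of ss) \<in> controls p"
        using controls_closed s(1) by blast
      moreover
      have "fst (head_action s i (ss ! i)) \<in> insert Blank (range symbol_of)"
        if "i < length ss" for i
        using head_action_alphabet[of "ss ! i" s i] ss nth_mem[OF that] by (auto simp: compile_def)
      then have "fst ` set (map (\<lambda>i. head_action s i (ss ! i)) [0..<length ss]) \<subseteq>
          insert Blank (range symbol_of)"
        by (simp add: image_subset_iff)
      ultimately show ?thesis
        using False inv ss ne by (simp add: compile_def Let_def)
    qed
  qed
  moreover have "finite (states ?M)" by (simp add: compile_def finite_controls)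
  moreover have "start ?M \<in> states ?M" using start by (simp add: compile_def)
  ultimately show ?thesis
    using assms(1) bits unfolding turing_machine_def by (simp add: compile_def)
qed

text \<open>The stack occupies the cells from the head position on to the right, top first.\<close>

definition cell :: "letter list \<Rightarrow> int \<Rightarrow> symbol" where
  "cell xs j = (if 0 \<le> j \<and> nat j < length xs then symbol_of (xs ! nat j) else Blank)"

definition holds :: "tape \<Rightarrow> letter list \<Rightarrow> bool" where
  "holds T xs \<longleftrightarrow> (\<forall>j. fst T j = cell xs (j - snd T))"

lemma cell_Cons: "cell (c # xs) j = (if j = 0 then symbol_of c else cell xs (j - 1))"
proof -
  consider "j < 0" | "j = 0" | "j > 0" by linarith
  then show ?thesis
  proof cases
    case 3
    then have "nat j = Suc (nat (j - 1))" by simp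
    then show ?thesis using 3 by (simp add: cell_def)
  qed (simp_all add: cell_def)
qed

lemma holds_push:
  "holds T xs \<Longrightarrow> holds (act (symbol_of c, Stay) (act (scanned T, Left) T)) (c # xs)"
  by (cases T) (auto simp: holds_def cell_Cons)

text \<open>\<open>holds\<close> requires blanks to the left of the head as well, so the popped cell
  is erased. On an empty stack the head wanders right over blank cells, which again represents the
  empty stack.\<close>

lemma holds_pop:
  assumes "holds T xs"
  shows "holds (act (Blank, Right) T) (tl xs)"
proof (cases T)
  case (Pair f pos)
  show ?thesis
  proof (cases xs)
    case Nil
    then show ?thesis using assms by (auto simp: Pair holds_def cell_def)
  next
    case (Cons c ys)
    have "cell ys (- 1) = Blank" by (simp add: cell_def)
    then show ?thesis
      using assms by (auto simp: Pair Cons holds_def cell_Cons algebra_simps)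
  qed
qed

lemma act_scanned_Stay [simp]: "act (scanned T, Stay) T = T"
  by (cases T) simp

lemma unsym_scanned: "holds T xs \<Longrightarrow> unsym (scanned T) = top_of xs"
  by (cases T; cases xs) (auto simp: holds_def cell_Cons, simp add: cell_def)

section \<open>Simulation of a run by the compiled machine\<close>

definition stacks :: "nat \<Rightarrow> tape list \<Rightarrow> store \<Rightarrow> bool" where
  "stacks k ts \<sigma> \<longleftrightarrow>
     length ts = k \<and> (\<forall>i<k. holds (ts ! i) (\<sigma> i)) \<and> (\<forall>i\<ge>k. \<sigma> i = [])"

lemma view_of_stacks: "stacks k ts \<sigma> \<Longrightarrow> view_of (map scanned ts) = tops \<sigma>"
  by (rule ext) (auto simp: view_of_def stacks_def unsym_scanned)

text \<open>Stated without \<open>stacks\<close>, because between the two steps of a push the head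
  stands on a blank in front of its stack, where the tape need not represent a stack.\<close>

lemma step_compile':
  assumes "inj_on num (controls p)" "s \<in> controls p" "fst s \<noteq> []"
  shows "step (compile k verdict p num) (num s + 2, ts) =
    (num (next_control s (view_of (map scanned ts))) + 2,
     map2 act (map (\<lambda>i. head_action s i (scanned (ts ! i))) [0..<length ts]) ts)"
proof -
  have "map (\<lambda>i. head_action s i (map scanned ts ! i)) [0..<length ts] =
      map (\<lambda>i. head_action s i (scanned (ts ! i))) [0..<length ts]"
    by (rule map_cong) auto
  then show ?thesis
    using assms by (simp add: step_def compile_def Let_def del: map_eq_conv)
qed

lemma step_compile:
  assumes "inj_on num (controls p)" "s \<in> controls p" "fst s \<noteq> []" "stacks k ts \<sigma>"
  shows "step (compile k verdict p num) (num s + 2, ts) =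
    (num (next_control s (tops \<sigma>)) + 2,
     map2 act (map (\<lambda>i. head_action s i (scanned (ts ! i))) [0..<length ts]) ts)"
  using step_compile'[OF assms(1-3)] view_of_stacks[OF assms(4)] by simp

lemma map2_act_idle:
  "map2 act (map (\<lambda>i. (scanned (ts ! i), Stay)) [0..<length ts]) ts = ts"
  by (rule nth_equalityI) auto

text \<open>The induction is on the run, with the pending list \<open>K\<close> arbitrary: the first
  half of a sequence and a loop body both run in front of a longer list. Each \<open>Suc\<close> in
  \<open>exec\<close> is the one transition that unfolds a control construct. The conditions on
  \<open>conts\<close> keep all lists within \<open>controls p0\<close>, where \<open>num\<close> is
  injective.\<close>

lemma exec_compile:
  fixes k :: nat and verdict :: "view \<Rightarrow> bool"
  assumes inj: "inj_on num (controls p0)"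
  defines "M \<equiv> compile k verdict p0 num"
  shows "exec p \<sigma> t \<tau> \<Longrightarrow> pushes_below k p \<Longrightarrow> conts p K \<subseteq> insert [] (conts p0 []) \<Longrightarrow>
    K \<in> insert [] (conts p0 []) \<Longrightarrow> stacks k ts \<sigma> \<Longrightarrow>
    \<exists>ts'. (step M ^^ t) (num (p # K, None) + 2, ts) = (num (K, None) + 2, ts') \<and> stacks k ts' \<tau>"
proof (induction arbitrary: K ts rule: exec.induct)
  case (exec_Skip \<sigma>)
  then have "(Skip # K, None) \<in> controls p0" by (simp add: controls_def)
  from step_compile[OF inj this _ exec_Skip(4)] exec_Skip show ?case
    by (simp add: M_def map2_act_idle)
next
  case (exec_Push i f \<sigma>)
  let ?L = "Push i f # K"
  have c: "(?L, x) \<in> controls p0" for x using exec_Push by (simp add: controls_def)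
  let ?ts1 = "map2 act (map (\<lambda>j. head_action (?L, None) j (scanned (ts ! j))) [0..<length ts]) ts"
  let ?c = "f (tops \<sigma>)"
  have len: "length ts = k" "i < k" using exec_Push by (auto simp: stacks_def)
  have "step M (num (?L, None) + 2, ts) = (num (?L, Some ?c) + 2, ?ts1)"
    using step_compile[OF inj c _ exec_Push(4)] by (simp add: M_def)
  moreover
  let ?ts2 = "map2 act (map (\<lambda>j. head_action (?L, Some ?c) j (scanned (?ts1 ! j))) [0..<length ?ts1]) ?ts1"
  have "step M (num (?L, Some ?c) + 2, ?ts1) = (num (K, None) + 2, ?ts2)"
    using step_compile'[OF inj c[of "Some ?c"]] by (simp add: M_def)
  moreover have "stacks k ?ts2 (\<sigma>(i := ?c # \<sigma> i))"
    using exec_Push len holds_push by (auto simp: stacks_def)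
  ultimately show ?case
    by (intro exI[of _ ?ts2]) (simp only: numeral_2_eq_2 funpow.simps o_apply id_apply simp_thms)
next
  case (exec_Pop i \<sigma>)
  then have "(Pop i # K, None) \<in> controls p0" by (simp add: controls_def)
  from step_compile[OF inj this _ exec_Pop(4)] exec_Pop show ?case
    by (auto simp: M_def stacks_def holds_pop)
next
  case (exec_Seq p \<sigma> t \<tau> q s \<upsilon>)
  then have "((p ;; q) # K, None) \<in> controls p0" by (simp add: controls_def)
  from step_compile[OF inj this _ exec_Seq.prems(4)]
  have 1: "step M (num ((p ;; q) # K, None) + 2, ts) = (num (p # q # K, None) + 2, ts)"
    by (simp add: M_def map2_act_idle)
  have "q # K \<in> insert [] (conts p0 [])"
    using exec_Seq.prems self_in_conts[of q K] by auto
  then obtain ts1 where 2: "(step M ^^ t) (num (p # q # K, None) + 2, ts) = (num (q # K, None) + 2, ts1)"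
      "stacks k ts1 \<tau>"
    using exec_Seq.IH(1)[of "q # K" ts] exec_Seq.prems by auto
  obtain ts2 where 3: "(step M ^^ s) (num (q # K, None) + 2, ts1) = (num (K, None) + 2, ts2)"
      "stacks k ts2 \<upsilon>"
    using exec_Seq.IH(2)[of K ts1] exec_Seq.prems 2 by auto
  have "(step M ^^ Suc (t + s)) (num ((p ;; q) # K, None) + 2, ts) = (num (K, None) + 2, ts2)"
    using 1 2(1) 3(1) by (simp add: funpow_Suc_right funpow_add add.commute[of t s] del: funpow.simps(2))
  with 3(2) show ?case by blast
next
  case (exec_Cond c \<sigma> p q t \<tau>)
  then have "(Cond c p q # K, None) \<in> controls p0" by (simp add: controls_def)
  from step_compile[OF inj this _ exec_Cond.prems(4)]
  have 1: "step M (num (Cond c p q # K, None) + 2, ts) =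
      (num ((if c (tops \<sigma>) then p else q) # K, None) + 2, ts)"
    by (simp add: M_def map2_act_idle)
  have "pushes_below k (if c (tops \<sigma>) then p else q)"
      "conts (if c (tops \<sigma>) then p else q) K \<subseteq> insert [] (conts p0 [])"
    using exec_Cond.prems by simp_all
  then obtain ts1 where 2: "(step M ^^ t) (num ((if c (tops \<sigma>) then p else q) # K, None) + 2, ts) =
      (num (K, None) + 2, ts1)" "stacks k ts1 \<tau>"
    using exec_Cond.IH[of K ts] exec_Cond.prems by blast
  then show ?case
    using 1 by (auto simp add: funpow_Suc_right simp del: funpow.simps(2))
next
  case (exec_Loop_stop c \<sigma> p)
  then have "(Loop c p # K, None) \<in> controls p0" by (simp add: controls_def)
  from step_compile[OF inj this _ exec_Loop_stop.prems(4)] exec_Loop_stop show ?case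
    by (simp add: M_def map2_act_idle)
next
  case (exec_Loop_step c \<sigma> p t \<tau> s \<upsilon>)
  then have "(Loop c p # K, None) \<in> controls p0" by (simp add: controls_def)
  from step_compile[OF inj this _ exec_Loop_step.prems(4)] exec_Loop_step.hyps
  have 1: "step M (num (Loop c p # K, None) + 2, ts) = (num (p # Loop c p # K, None) + 2, ts)"
    by (simp add: M_def map2_act_idle)
  obtain ts1 where 2: "(step M ^^ t) (num (p # Loop c p # K, None) + 2, ts) =
      (num (Loop c p # K, None) + 2, ts1)" "stacks k ts1 \<tau>"
    using exec_Loop_step.IH(1)[of "Loop c p # K" ts] exec_Loop_step.prems by auto
  obtain ts2 where 3: "(step M ^^ s) (num (Loop c p # K, None) + 2, ts1) = (num (K, None) + 2, ts2)"
      "stacks k ts2 \<upsilon>"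
    using exec_Loop_step.IH(2)[of K ts1] exec_Loop_step.prems 2 by auto
  have "(step M ^^ Suc (t + s)) (num (Loop c p # K, None) + 2, ts) = (num (K, None) + 2, ts2)"
    using 1 2(1) 3(1) by (simp add: funpow_Suc_right funpow_add add.commute[of t s] del: funpow.simps(2))
  with 3(2) show ?case by blast
qed

definition input_store :: "bool list \<Rightarrow> store" where
  "input_store x = (\<lambda>_. [])(0 := map Digit x)"

lemma stacks_initial:
  assumes "k \<ge> 1"
  shows "stacks k (input_tape x # replicate (k - 1) (\<lambda>_. Blank, 0)) (input_store x)"
proof -
  have "holds (input_tape x) (map Digit x)"
    by (auto simp: holds_def input_tape_def cell_def)
  moreover have "holds (\<lambda>_. Blank, 0) []"
    by (simp add: holds_def cell_def)
  ultimately show ?thesis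
    using assms by (auto simp: stacks_def input_store_def nth_Cons split: nat.split)
qed

lemma step_halted: "q = accept M \<or> q = reject M \<Longrightarrow> (step M ^^ t) (q, ts) = (q, ts)"
  by (induction t) (auto simp: step_def)

text \<open>\<open>state_after\<close> is read at a single time, whereas the program may stop
  earlier. A halted configuration is a fixed point of \<open>step\<close>, so an upper bound on the
  running time is enough.\<close>

theorem prog_decides:
  assumes "k \<ge> 1" and below: "pushes_below k p"
    and run: "\<And>x. \<exists>t \<tau>. exec p (input_store x) t \<tau> \<and> t \<le> poly P (length x) \<and> (verdict (tops \<tau>) \<longleftrightarrow> Y x)"
  shows "\<exists>M (P :: nat poly). turing_machine M \<and>
    (\<forall>x. state_after M x (poly P (length x)) = (if Y x then accept M else reject M))"
proof -
  obtain num :: "control \<Rightarrow> nat" where inj: "inj_on num (controls p)"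
    using finite_controls finite_imp_inj_to_nat_seg by metis
  let ?M = "compile k verdict p num"
  \<comment> \<open>The added 1 pays for the transition that turns the empty list into the
    answer.\<close>
  have "state_after ?M x (poly (P + 1) (length x)) = (if Y x then accept ?M else reject ?M)" for x
  proof -
    obtain t \<tau> where t: "exec p (input_store x) t \<tau>" "t \<le> poly P (length x)" "verdict (tops \<tau>) \<longleftrightarrow> Y x"
      using run by blast
    let ?ts = "input_tape x # replicate (k - 1) (\<lambda>_. Blank, 0)"
    obtain ts' where ts': "(step ?M ^^ t) (num ([p], None) + 2, ?ts) = (num ([], None) + 2, ts')"
        "stacks k ts' \<tau>"
      using exec_compile[OF inj t(1) below, of "[]" ?ts] stacks_initial[OF assms(1)] by blast
    have "([], None) \<in> controls p" by (simp add: controls_def)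
    then have "fst (step ?M (num ([], None) + 2, ts')) = (if Y x then accept ?M else reject ?M)"
      using inj t(3) by (simp add: step_def compile_def Let_def view_of_stacks[OF ts'(2)])
    moreover have "initial ?M x = (num ([p], None) + 2, ?ts)"
      by (simp add: initial_def compile_def)
    ultimately have fin: "fst ((step ?M ^^ Suc t) (initial ?M x)) = (if Y x then accept ?M else reject ?M)"
      using ts'(1) by simp
    have "poly (P + 1) (length x) = (poly P (length x) - t) + Suc t" using t(2) by simp
    then have "(step ?M ^^ poly (P + 1) (length x)) (initial ?M x) =
        (step ?M ^^ (poly P (length x) - t)) ((step ?M ^^ Suc t) (initial ?M x))"
      by (metis funpow_add comp_apply)
    also have "\<dots> = (step ?M ^^ Suc t) (initial ?M x)"
      using step_halted fin by (metis prod.collapse)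
    finally show ?thesis using fin by (simp add: state_after_def)
  qed
  then show ?thesis using turing_machine_compile[OF assms(1) inj] by blast
qed

section \<open>Running time of programs\<close>

text \<open>An upper bound in place of the exact time can be rounded up by \<open>runs_mono\<close>
  whenever programs are composed.\<close>

definition runs :: "prog \<Rightarrow> store \<Rightarrow> store \<Rightarrow> nat \<Rightarrow> bool" where
  "runs p \<sigma> \<tau> T \<longleftrightarrow> (\<exists>t\<le>T. exec p \<sigma> t \<tau>)"

lemma runs_mono: "runs p \<sigma> \<tau> T \<Longrightarrow> \<tau> = \<tau>' \<Longrightarrow> T \<le> T' \<Longrightarrow> runs p \<sigma> \<tau>' T'"
  unfolding runs_def by (meson le_trans)

lemma runs_Seq:
  assumes "runs p \<sigma> \<tau> a" "runs q \<tau> \<upsilon> b"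
  shows "runs (p ;; q) \<sigma> \<upsilon> (a + b + 1)"
proof -
  obtain t s where "exec p \<sigma> t \<tau>" "t \<le> a" "exec q \<tau> s \<upsilon>" "s \<le> b"
    using assms by (auto simp: runs_def)
  then show ?thesis unfolding runs_def by (intro exI[of _ "Suc (t + s)"]) (simp add: exec_Seq)
qed

lemma runs_Cond:
  "runs (if c (tops \<sigma>) then p else q) \<sigma> \<tau> a \<Longrightarrow> runs (Cond c p q) \<sigma> \<tau> (a + 1)"
  unfolding runs_def using exec_Cond by fastforce

lemma runs_Loop_stop: "\<not> c (tops \<sigma>) \<Longrightarrow> runs (Loop c p) \<sigma> \<sigma> 1"
  unfolding runs_def using exec_Loop_stop by blast

lemma runs_Loop_step:
  assumes "c (tops \<sigma>)" "runs p \<sigma> \<tau> a" "runs (Loop c p) \<tau> \<upsilon> b"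
  shows "runs (Loop c p) \<sigma> \<upsilon> (a + b + 1)"
proof -
  obtain t s where "exec p \<sigma> t \<tau>" "t \<le> a" "exec (Loop c p) \<tau> s \<upsilon>" "s \<le> b"
    using assms by (auto simp: runs_def)
  then show ?thesis unfolding runs_def
    by (intro exI[of _ "Suc (t + s)"]) (simp add: exec_Loop_step[of c, OF assms(1)])
qed

primrec loop_free :: "prog \<Rightarrow> bool" where
  "loop_free Skip \<longleftrightarrow> True"
| "loop_free (Push i f) \<longleftrightarrow> True"
| "loop_free (Pop i) \<longleftrightarrow> True"
| "loop_free (p ;; q) \<longleftrightarrow> loop_free p \<and> loop_free q"
| "loop_free (Cond c p q) \<longleftrightarrow> loop_free p \<and> loop_free q"
| "loop_free (Loop c p) \<longleftrightarrow> False"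

text \<open>For a loop-free program the final store is a function that the simplifier evaluates, and
  \<open>cost\<close> bounds the time independently of the store, adding up both branches of a
  conditional. The clauses for \<open>Loop\<close> are default values.\<close>

primrec result :: "prog \<Rightarrow> store \<Rightarrow> store" where
  "result Skip \<sigma> = \<sigma>"
| "result (Push i f) \<sigma> = \<sigma>(i := f (tops \<sigma>) # \<sigma> i)"
| "result (Pop i) \<sigma> = \<sigma>(i := tl (\<sigma> i))"
| "result (p ;; q) \<sigma> = result q (result p \<sigma>)"
| "result (Cond c p q) \<sigma> = (if c (tops \<sigma>) then result p \<sigma> else result q \<sigma>)"
| "result (Loop c p) \<sigma> = \<sigma>"

primrec cost :: "prog \<Rightarrow> nat" where
  "cost Skip = 1"
| "cost (Push i f) = 2"
| "cost (Pop i) = 1"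
| "cost (p ;; q) = cost p + cost q + 1"
| "cost (Cond c p q) = cost p + cost q + 1"
| "cost (Loop c p) = 0"

lemma runs_loop_free: "loop_free p \<Longrightarrow> runs p \<sigma> (result p \<sigma>) (cost p)"
proof (induction p arbitrary: \<sigma>)
  case (Seq p q)
  then show ?case using runs_Seq by fastforce
next
  case (Cond c p q)
  have "runs (if c (tops \<sigma>) then p else q) \<sigma> (result (Cond c p q) \<sigma>) (cost p + cost q)"
    by (cases "c (tops \<sigma>)")
       (use Cond in \<open>simp_all add: runs_mono[OF _ refl le_add1] runs_mono[OF _ refl le_add2]\<close>)
  from runs_Cond[of c \<sigma> p q, OF this] show ?case by simp
qed (auto simp: runs_def intro: exec.intros[unfolded One_nat_def])

section \<open>Moving and copying\<close>

definition move_while :: "(letter \<Rightarrow> bool) \<Rightarrow> nat \<Rightarrow> nat \<Rightarrow> prog" where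
  "move_while g i j =
     Loop (\<lambda>v. \<exists>c. v i = Some c \<and> g c) (Push j (\<lambda>v. the (v i)) ;; Pop i)"

definition copy_while :: "(letter \<Rightarrow> bool) \<Rightarrow> nat \<Rightarrow> nat \<Rightarrow> nat \<Rightarrow> prog" where
  "copy_while g i j k =
     Loop (\<lambda>v. \<exists>c. v i = Some c \<and> g c)
       (Push j (\<lambda>v. the (v i)) ;; Push k (\<lambda>v. the (v i)) ;; Pop i)"

lemma takeWhile_dropWhile_True [simp]:
  "takeWhile (\<lambda>_. True) xs = xs" "dropWhile (\<lambda>_. True) xs = []"
  by (induction xs) simp_all

definition clear :: "nat \<Rightarrow> prog" where
  "clear i = Loop (\<lambda>v. v i \<noteq> None) (Pop i)"

text \<open>Serves to pass over a separator if there is one. The test guards against pushing the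
  unspecified letter \<open>the None\<close> from an empty stack.\<close>

definition hop :: "nat \<Rightarrow> nat \<Rightarrow> prog" where
  "hop i j = Cond (\<lambda>v. v i = None) Skip (Push j (\<lambda>v. the (v i)) ;; Pop i)"

text \<open>A flag is a stack with at most one letter. Raising a raised flag does nothing, so a
  single \<open>Pop\<close> always lowers it.\<close>

definition raise :: "nat \<Rightarrow> prog" where
  "raise f = Cond (\<lambda>v. v f = None) (Push f (\<lambda>_. Bar)) Skip"

definition raised :: "nat \<Rightarrow> bool \<Rightarrow> store \<Rightarrow> store" where
  "raised f b \<sigma> = (if b \<and> \<sigma> f = [] then \<sigma>(f := [Bar]) else \<sigma>)"

lemma raised_False [simp]: "raised f False \<sigma> = \<sigma>"
  by (simp add: raised_def)

lemma raised_apply: "raised f b \<sigma> i = (if i = f \<and> b \<and> \<sigma> f = [] then [Bar] else \<sigma> i)"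
  by (simp add: raised_def)

lemma result_raise [simp]: "result (raise f) \<sigma> = raised f True \<sigma>"
  by (simp add: raise_def raised_def)

lemma loop_free_raise [simp]: "loop_free (raise f)" "cost (raise f) = 4"
  by (simp_all add: raise_def)

lemma loop_free_hop [simp]: "loop_free (hop i j)" "cost (hop i j) = 6"
  by (simp_all add: hop_def)

lemma result_hop:
  "i \<noteq> j \<Longrightarrow> result (hop i j) \<sigma> =
     (case \<sigma> i of [] \<Rightarrow> \<sigma> | c # cs \<Rightarrow> \<sigma>(i := cs, j := c # \<sigma> j))"
  by (auto simp: hop_def fun_eq_iff split: list.split)

lemma runs_move_while:
  assumes "i \<noteq> j"
  shows "runs (move_while g i j) \<sigma>
    (\<sigma>(i := dropWhile g (\<sigma> i), j := rev (takeWhile g (\<sigma> i)) @ \<sigma> j)) (5 * length (\<sigma> i) + 1)"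
proof (induction "\<sigma> i" arbitrary: \<sigma>)
  case Nil
  show ?case unfolding move_while_def
    by (rule runs_mono[OF runs_Loop_stop]) (simp_all add: fun_eq_iff flip: Nil)
next
  case (Cons c cs)
  show ?case
  proof (cases "g c")
    case True
    let ?p = "Push j (\<lambda>v. the (v i)) ;; Pop i"
    have "runs (move_while g i j) (result ?p \<sigma>)
        (\<sigma>(i := dropWhile g cs, j := rev (takeWhile g cs) @ c # \<sigma> j)) (5 * length cs + 1)"
      by (rule runs_mono[OF Cons.hyps(1)])
         (use assms in \<open>simp_all add: fun_eq_iff flip: Cons.hyps(2)\<close>)
    note IH = this[unfolded move_while_def]
    show ?thesis unfolding move_while_def
      by (rule runs_mono[OF runs_Loop_step[OF _ runs_loop_free[of ?p] IH]])
         (use True in \<open>simp_all flip: Cons.hyps(2)\<close>)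
  next
    case False
    then show ?thesis unfolding move_while_def
      by (intro runs_mono[OF runs_Loop_stop]) (simp_all add: fun_eq_iff flip: Cons.hyps(2))
  qed
qed

text \<open>The time is measured by the copied prefix and not by the whole stack; otherwise the
  bound for splitting a text into segments would become quadratic. The 8 steps per letter are two
  pushes of 2, a pop, two sequencings and the loop test.\<close>

lemma runs_copy_while:
  assumes "distinct [i, j, k]"
  shows "runs (copy_while g i j k) \<sigma>
    (\<sigma>(i := dropWhile g (\<sigma> i), j := rev (takeWhile g (\<sigma> i)) @ \<sigma> j,
       k := rev (takeWhile g (\<sigma> i)) @ \<sigma> k)) (8 * length (takeWhile g (\<sigma> i)) + 1)"
proof (induction "\<sigma> i" arbitrary: \<sigma>)
  case Nil
  show ?case unfolding copy_while_def
    by (rule runs_mono[OF runs_Loop_stop]) (simp_all add: fun_eq_iff flip: Nil)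
next
  case (Cons c cs)
  show ?case
  proof (cases "g c")
    case True
    let ?p = "Push j (\<lambda>v. the (v i)) ;; Push k (\<lambda>v. the (v i)) ;; Pop i"
    have "runs (copy_while g i j k) (result ?p \<sigma>)
        (\<sigma>(i := dropWhile g cs, j := rev (takeWhile g cs) @ c # \<sigma> j,
           k := rev (takeWhile g cs) @ c # \<sigma> k)) (8 * length (takeWhile g cs) + 1)"
      by (rule runs_mono[OF Cons.hyps(1)])
         (use assms in \<open>auto simp add: fun_eq_iff simp flip: Cons.hyps(2)\<close>)
    note IH = this[unfolded copy_while_def]
    show ?thesis unfolding copy_while_def
      by (rule runs_mono[OF runs_Loop_step[OF _ runs_loop_free[of ?p] IH]])
         (use True in \<open>simp_all flip: Cons.hyps(2)\<close>)
  next
    case False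
    then show ?thesis unfolding copy_while_def
      by (intro runs_mono[OF runs_Loop_stop]) (simp_all add: fun_eq_iff flip: Cons.hyps(2))
  qed
qed

lemma runs_clear: "runs (clear i) \<sigma> (\<sigma>(i := [])) (2 * length (\<sigma> i) + 1)"
proof (induction "\<sigma> i" arbitrary: \<sigma>)
  case Nil
  show ?case unfolding clear_def
    by (rule runs_mono[OF runs_Loop_stop]) (simp_all add: fun_eq_iff flip: Nil)
next
  case (Cons c cs)
  have "runs (clear i) (result (Pop i) \<sigma>) (\<sigma>(i := [])) (2 * length cs + 1)"
    by (rule runs_mono[OF Cons.hyps(1)]) (simp_all add: fun_eq_iff flip: Cons.hyps(2))
  note IH = this[unfolded clear_def]
  show ?case unfolding clear_def
    by (rule runs_mono[OF runs_Loop_step[OF _ runs_loop_free[of "Pop i"] IH]])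
       (simp_all flip: Cons.hyps(2))
qed

section \<open>Iterating over segments\<close>

text \<open>\<open>d\<close> acts as a terminator: a final \<open>d\<close> opens no further
  segment, while a leading one yields an empty segment.\<close>

function segs :: "letter \<Rightarrow> letter list \<Rightarrow> letter list list" where
  "segs d [] = []"
| "segs d (x # xs) = takeWhile (\<lambda>c. c \<noteq> d) (x # xs) #
     segs d (tl (dropWhile (\<lambda>c. c \<noteq> d) (x # xs)))"
  by pat_completeness auto
termination
  by (relation "measure (\<lambda>(d, xs). length xs)") (auto simp: length_dropWhile_le less_Suc_eq_le
      intro: le_trans[OF diff_le_self])

text \<open>Runs \<open>body\<close> once for each segment, which it finds reversed on the stack \<open>cur\<close>.\<close>

definition each_segment :: "letter \<Rightarrow> nat \<Rightarrow> nat \<Rightarrow> nat \<Rightarrow> prog \<Rightarrow> prog" where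
  "each_segment d src cur back body =
     Loop (\<lambda>v. v src \<noteq> None)
       (copy_while (\<lambda>c. c \<noteq> d) src back cur ;; hop src back ;; body ;; clear cur) ;;
     move_while (\<lambda>_. True) back src"

lemma segs_step:
  assumes "xs \<noteq> []"
  obtains s zs r where "takeWhile (\<lambda>c. c \<noteq> d) xs = s" "dropWhile (\<lambda>c. c \<noteq> d) xs = zs"
    "segs d xs = s # segs d (tl zs)" "xs = s @ zs" "length (tl zs) < length xs"
    "length s + length (tl zs) \<le> length xs"
proof -
  define s where "s = takeWhile (\<lambda>c. c \<noteq> d) xs"
  define z where "z = dropWhile (\<lambda>c. c \<noteq> d) xs"
  have eq: "xs = s @ z" by (simp add: s_def z_def)
  have seg: "segs d xs = s # segs d (tl z)"
    using assms by (cases xs) (simp_all add: s_def z_def)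
  have "length (tl z) < length xs" "length s + length (tl z) \<le> length xs"
    using eq assms by (cases z; auto)+
  from that[OF s_def[symmetric] z_def[symmetric] seg eq this] show ?thesis .
qed

text \<open>\<open>src\<close>, \<open>back\<close> and the flag \<open>f\<close> change from round
  to round, so the body is assumed correct on all stores that agree with a fixed
  \<open>\<rho>\<close> elsewhere. It must cope with \<open>f\<close> being raised already, and thus
  the flag accumulates a disjunction. Every round consumes at least one letter of
  \<open>src\<close>, so there are at most \<open>length xs\<close> rounds.\<close>

lemma runs_each_segment_loop:
  assumes dist: "distinct [src, cur, back, f]"
    and "\<And>s \<tau>. s \<in> set (segs d xs) \<Longrightarrow> (\<And>i. i \<notin> {src, cur, back, f} \<Longrightarrow> \<tau> i = \<rho> i) \<Longrightarrow>
      \<tau> cur = rev s \<Longrightarrow> runs body \<tau> (raised f (P s) \<tau>) T"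
    and "\<sigma> src = xs" "\<sigma> cur = []" "\<And>i. i \<notin> {src, cur, back, f} \<Longrightarrow> \<sigma> i = \<rho> i"
  shows "runs (Loop (\<lambda>v. v src \<noteq> None)
       (copy_while (\<lambda>c. c \<noteq> d) src back cur ;; hop src back ;; body ;; clear cur)) \<sigma>
     ((raised f (\<exists>s\<in>set (segs d xs). P s) \<sigma>)(src := [], back := rev xs @ \<sigma> back))
     ((T + 30) * length xs + 1)"
  using assms(2-)
proof (induction "length xs" arbitrary: xs \<sigma> rule: less_induct)
  case less
  note body = less.prems(1) and src = less.prems(2) and cur = less.prems(3) and \<rho> = less.prems(4)
  show ?case
  proof (cases "xs = []")
    case True
    show ?thesis
      by (rule runs_mono[OF runs_Loop_stop]) (use True src in \<open>auto simp: fun_eq_iff raised_def\<close>)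
  next
    case False
    let ?loop = "Loop (\<lambda>v. v src \<noteq> None)
      (copy_while (\<lambda>c. c \<noteq> d) src back cur ;; hop src back ;; body ;; clear cur)"
    obtain s zs where s: "takeWhile (\<lambda>c. c \<noteq> d) xs = s" "dropWhile (\<lambda>c. c \<noteq> d) xs = zs"
      "segs d xs = s # segs d (tl zs)" "xs = s @ zs" "length (tl zs) < length xs"
      "length s + length (tl zs) \<le> length xs"
      using segs_step[OF False] by blast
    \<comment> \<open>The separator, or nothing when the last segment is unterminated.\<close>
    let ?hd = "take 1 zs"
    have zs: "zs = ?hd @ tl zs" by (cases zs) auto
    define \<sigma>1 where "\<sigma>1 = \<sigma>(src := zs, back := rev s @ \<sigma> back, cur := rev s)"
    define \<sigma>2 where "\<sigma>2 = \<sigma>(src := tl zs, back := rev ?hd @ rev s @ \<sigma> back, cur := rev s)"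
    define \<sigma>3 where "\<sigma>3 = raised f (P s) \<sigma>2"
    define \<sigma>4 where "\<sigma>4 = \<sigma>3(cur := [])"
    have 1: "runs (copy_while (\<lambda>c. c \<noteq> d) src back cur) \<sigma> \<sigma>1 (8 * length s + 1)"
      by (rule runs_mono[OF runs_copy_while])
         (use dist src cur s in \<open>auto simp: \<sigma>1_def fun_eq_iff\<close>)
    have 2: "runs (hop src back) \<sigma>1 \<sigma>2 6"
      by (rule runs_mono[OF runs_loop_free])
         (use dist in \<open>auto simp: \<sigma>1_def \<sigma>2_def fun_eq_iff result_hop split: list.split\<close>)
    have 3: "runs body \<sigma>2 \<sigma>3 T" unfolding \<sigma>3_def
      by (rule body) (use s dist \<rho> in \<open>auto simp: \<sigma>2_def\<close>)
    have 4: "runs (clear cur) \<sigma>3 \<sigma>4 (2 * length s + 1)"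
      by (rule runs_mono[OF runs_clear])
         (use dist in \<open>auto simp: \<sigma>4_def \<sigma>3_def \<sigma>2_def raised_apply\<close>)
    note it = runs_Seq[OF 1 runs_Seq[OF 2 runs_Seq[OF 3 4]]]
    have "runs ?loop \<sigma>4
        ((raised f (\<exists>s\<in>set (segs d (tl zs)). P s) \<sigma>4)(src := [], back := rev (tl zs) @ \<sigma>4 back))
        ((T + 30) * length (tl zs) + 1)"
    proof (rule less.hyps[OF s(5)])
      show "runs body \<tau> (raised f (P t) \<tau>) T"
        if "t \<in> set (segs d (tl zs))" "\<And>i. i \<notin> {src, cur, back, f} \<Longrightarrow> \<tau> i = \<rho> i" "\<tau> cur = rev t"
        for t \<tau>
        by (rule body) (use that s(3) in auto)
    qed (use dist \<rho> in \<open>auto simp: \<sigma>4_def \<sigma>3_def \<sigma>2_def raised_apply\<close>)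
    moreover have "(raised f (\<exists>s\<in>set (segs d (tl zs)). P s) \<sigma>4)
          (src := [], back := rev (tl zs) @ \<sigma>4 back) =
        (raised f (\<exists>s\<in>set (segs d xs). P s) \<sigma>)(src := [], back := rev xs @ \<sigma> back)"
    proof -
      have "rev xs = rev (tl zs) @ rev ?hd @ rev s" by (metis s(4) zs rev_append append.assoc)
      then show ?thesis using dist cur s(3)
        by (auto simp: fun_eq_iff \<sigma>4_def \<sigma>3_def \<sigma>2_def raised_def)
    qed
    ultimately have rest: "runs ?loop \<sigma>4
        ((raised f (\<exists>s\<in>set (segs d xs). P s) \<sigma>)(src := [], back := rev xs @ \<sigma> back))
        ((T + 30) * length (tl zs) + 1)" by simp
    \<comment> \<open>\<open>m\<close> counts the letters consumed in this round. Since
      \<open>m \<ge> 1\<close>, they pay for one run of the body and the fixed overhead as well as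
      for copying and clearing \<open>s\<close>.\<close>
    define m where "m = length xs - length (tl zs)"
    have m: "length xs = length (tl zs) + m" "m \<ge> 1" "length s \<le> m" using s by (simp_all add: m_def)
    have "T \<le> T * m" using m(2) by simp
    then have time: "8 * length s + T + 2 * length s + 14 \<le> (T + 30) * m"
      using m unfolding distrib_right by linarith
    show ?thesis
      by (rule runs_mono[OF runs_Loop_step[OF _ it rest]])
         (use time m(1) src False in \<open>simp_all add: algebra_simps\<close>)
  qed
qed

lemma runs_each_segment:
  assumes dist: "distinct [src, cur, back, f]"
    and "\<And>s \<tau>. s \<in> set (segs d (\<sigma> src)) \<Longrightarrow> (\<And>i. i \<notin> {src, cur, back, f} \<Longrightarrow> \<tau> i = \<sigma> i) \<Longrightarrow>
      \<tau> cur = rev s \<Longrightarrow> runs body \<tau> (raised f (P s) \<tau>) T"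
    and "\<sigma> cur = []" "\<sigma> back = []" and len: "length (\<sigma> src) \<le> n"
  shows "runs (each_segment d src cur back body) \<sigma>
     (raised f (\<exists>s\<in>set (segs d (\<sigma> src)). P s) \<sigma>) ((T + 40) * n + 3)"
proof -
  have "runs (each_segment d src cur back body) \<sigma>
     (raised f (\<exists>s\<in>set (segs d (\<sigma> src)). P s) \<sigma>) ((T + 40) * length (\<sigma> src) + 3)"
    unfolding each_segment_def
    by (rule runs_mono[OF runs_Seq[OF
          runs_each_segment_loop[where \<rho> = \<sigma> and P = P and f = f and T = T] runs_move_while]])
       (use assms in \<open>auto simp: fun_eq_iff raised_apply algebra_simps\<close>)
  then show ?thesis by (rule runs_mono[OF _ refl]) (use len in simp)
qed

section \<open>Arithmetic on stacks\<close>

text \<open>Least significant digit first. Every letter but \<open>Digit True\<close> counts as 0,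
  which gives the arithmetic a meaning on malformed input too.\<close>

primrec val :: "letter list \<Rightarrow> nat" where
  "val [] = 0"
| "val (c # cs) = of_bool (c = Digit True) + 2 * val cs"

abbreviation bit :: "letter option \<Rightarrow> bool" where
  "bit x \<equiv> x = Some (Digit True)"

lemma val_unfold: "val xs = of_bool (bit (top_of xs)) + 2 * val (tl xs)"
  by (cases xs) auto

text \<open>School addition with the carry as flag \<open>c\<close>; a stack that has run out
  supplies zeros. The digit is pushed before the carry is updated, as it depends on the old carry.
  The digits of \<open>x\<close> are saved on \<open>bk\<close> because multiplication uses
  \<open>x\<close> again.\<close>

definition add_loop :: "nat \<Rightarrow> nat \<Rightarrow> nat \<Rightarrow> nat \<Rightarrow> nat \<Rightarrow> prog" where
  "add_loop x r y c bk =
     Loop (\<lambda>v. v x \<noteq> None \<or> v r \<noteq> None)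
       (Push y (\<lambda>v. Digit (bit (v x) \<noteq> (bit (v r) \<noteq> (v c \<noteq> None)))) ;;
        Cond (\<lambda>v. if v c \<noteq> None then bit (v x) \<or> bit (v r) else bit (v x) \<and> bit (v r))
          (raise c) (Pop c) ;;
        hop x bk ;; Pop r)"

definition add :: "nat \<Rightarrow> nat \<Rightarrow> nat \<Rightarrow> nat \<Rightarrow> nat \<Rightarrow> prog" where
  "add x r y c bk =
     add_loop x r y c bk ;;
     Cond (\<lambda>v. v c \<noteq> None) (Push y (\<lambda>_. Digit True) ;; Pop c) Skip ;;
     move_while (\<lambda>_. True) y r ;; move_while (\<lambda>_. True) bk x"

definition flag :: "bool \<Rightarrow> letter list" where
  "flag b = (if b then [Bar] else [])"

lemma flag_simps [simp]:
  "flag True = [Bar]" "flag False = []" "flag b = [] \<longleftrightarrow> \<not> b" "tl (flag b) = []"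
  by (simp_all add: flag_def)

lemma runs_add_loop:
  assumes "distinct [x, r, y, c, bk]" "length (\<sigma> x) \<le> n" "length (\<sigma> r) \<le> n" "\<sigma> c = flag b"
  shows "\<exists>zs e. runs (add_loop x r y c bk) \<sigma>
      (\<sigma>(x := [], r := [], y := rev zs @ \<sigma> y, c := flag e, bk := rev (\<sigma> x) @ \<sigma> bk)) (24 * n + 1) \<and>
    length zs \<le> n \<and> val (\<sigma> x) + val (\<sigma> r) + of_bool b = val (zs @ (if e then [Digit True] else []))"
  using assms(2-)
proof (induction n arbitrary: \<sigma> b)
  case 0
  then show ?case
    by (intro exI[of _ "[]"] exI[of _ b] conjI, unfold add_loop_def,
        intro runs_mono[OF runs_Loop_stop]) (auto simp: fun_eq_iff)
next
  case (Suc n)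
  show ?case
  proof (cases "\<sigma> x = [] \<and> \<sigma> r = []")
    case True
    then show ?thesis using Suc.prems
      by (intro exI[of _ "[]"] exI[of _ b] conjI, unfold add_loop_def,
          intro runs_mono[OF runs_Loop_stop]) (auto simp: fun_eq_iff)
  next
    case False
    let ?p = "Push y (\<lambda>v. Digit (bit (v x) \<noteq> (bit (v r) \<noteq> (v c \<noteq> None)))) ;;
        Cond (\<lambda>v. if v c \<noteq> None then bit (v x) \<or> bit (v r) else bit (v x) \<and> bit (v r))
          (raise c) (Pop c) ;; hop x bk ;; Pop r"
    let ?X = "bit (top_of (\<sigma> x))" and ?R = "bit (top_of (\<sigma> r))"
    define z where "z = (?X \<noteq> (?R \<noteq> b))"
    define b' where "b' = (if b then ?X \<or> ?R else ?X \<and> ?R)"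
    define \<tau> where "\<tau> = \<sigma>(y := Digit z # \<sigma> y, c := flag b', bk := rev (take 1 (\<sigma> x)) @ \<sigma> bk,
      x := tl (\<sigma> x), r := tl (\<sigma> r))"
    have "result ?p \<sigma> = \<tau>"
      using assms(1) Suc.prems
      by (auto simp: \<tau>_def z_def b'_def fun_eq_iff result_hop raised_apply split: list.split)
    then have p: "runs ?p \<sigma> \<tau> 18" using runs_loop_free[of ?p \<sigma>] by simp
    obtain zs e where IH: "runs (add_loop x r y c bk) \<tau>
        (\<tau>(x := [], r := [], y := rev zs @ \<tau> y, c := flag e, bk := rev (\<tau> x) @ \<tau> bk)) (24 * n + 1)"
      "length zs \<le> n"
      "val (\<tau> x) + val (\<tau> r) + of_bool b' = val (zs @ (if e then [Digit True] else []))"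
    proof -
      have "length (\<tau> x) \<le> n" "length (\<tau> r) \<le> n" "\<tau> c = flag b'"
        using Suc.prems assms(1) by (auto simp: \<tau>_def)
      from Suc.IH[OF this] show ?thesis using that by blast
    qed
    have "runs (add_loop x r y c bk) \<sigma>
      (\<sigma>(x := [], r := [], y := rev (Digit z # zs) @ \<sigma> y, c := flag e, bk := rev (\<sigma> x) @ \<sigma> bk))
      (24 * Suc n + 1)"
      unfolding add_loop_def
    proof (rule runs_mono[OF runs_Loop_step[OF _ p IH(1)[unfolded add_loop_def]]])
      have "rev (tl (\<sigma> x)) @ rev (take 1 (\<sigma> x)) = rev (\<sigma> x)" by (cases "\<sigma> x") auto
      then show "\<tau>(x := [], r := [], y := rev zs @ \<tau> y, c := flag e, bk := rev (\<tau> x) @ \<tau> bk) =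
          \<sigma>(x := [], r := [], y := rev (Digit z # zs) @ \<sigma> y, c := flag e, bk := rev (\<sigma> x) @ \<sigma> bk)"
        using assms(1) by (auto simp: \<tau>_def fun_eq_iff)
    qed (use False in auto)
    moreover have "val (\<sigma> x) + val (\<sigma> r) + of_bool b =
        val ((Digit z # zs) @ (if e then [Digit True] else []))"
    proof -
      have "val (\<sigma> x) + val (\<sigma> r) + of_bool b = of_bool ?X + of_bool ?R + of_bool b +
          2 * (val (\<tau> x) + val (\<tau> r))"
        using assms(1) val_unfold[of "\<sigma> x"] val_unfold[of "\<sigma> r"] by (simp add: \<tau>_def)
      \<comment> \<open>The full adder: \<open>z\<close> is the parity and \<open>b'\<close> the
        majority of the three bits.\<close>
      also have "of_bool ?X + of_bool ?R + of_bool b = of_bool z + 2 * (of_bool b' :: nat)"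
        by (auto simp: z_def b'_def)
      finally show ?thesis using IH(3) by simp
    qed
    moreover have "length (Digit z # zs) \<le> Suc n" using IH(2) by simp
    ultimately show ?thesis by blast
  qed
qed

lemma runs_add:
  assumes dist: "distinct [x, r, y, c, bk]" and len: "length (\<sigma> x) \<le> n" "length (\<sigma> r) \<le> n"
    and empty: "\<sigma> y = []" "\<sigma> c = []" "\<sigma> bk = []"
  shows "\<exists>zs. runs (add x r y c bk) \<sigma> (\<sigma>(r := zs)) (40 * n + 40) \<and>
    length zs \<le> n + 1 \<and> val zs = val (\<sigma> x) + val (\<sigma> r)"
proof -
  obtain zs e where 1: "runs (add_loop x r y c bk) \<sigma>
      (\<sigma>(x := [], r := [], y := rev zs @ \<sigma> y, c := flag e, bk := rev (\<sigma> x) @ \<sigma> bk)) (24 * n + 1)"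
      (is "runs _ _ ?\<tau> _")
    and zs: "length zs \<le> n" "val (\<sigma> x) + val (\<sigma> r) + of_bool False = val (zs @ (if e then [Digit True] else []))"
    using runs_add_loop[OF dist len, of False] empty by auto
  let ?zs = "zs @ (if e then [Digit True] else [])"
  let ?p = "Cond (\<lambda>v. v c \<noteq> None) (Push y (\<lambda>_. Digit True) ;; Pop c) Skip"
  define \<tau>2 where "\<tau>2 = \<sigma>(x := [], r := [], y := rev ?zs, bk := rev (\<sigma> x))"
  define \<tau>3 where "\<tau>3 = \<sigma>(x := [], r := ?zs, bk := rev (\<sigma> x))"
  have 2: "runs ?p ?\<tau> \<tau>2 6"
    by (rule runs_mono[OF runs_loop_free]) (use dist empty in \<open>auto simp: \<tau>2_def fun_eq_iff\<close>)
  have 3: "runs (move_while (\<lambda>_. True) y r) \<tau>2 \<tau>3 (5 * n + 6)"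
    by (rule runs_mono[OF runs_move_while])
       (use dist empty zs(1) in \<open>auto simp: \<tau>2_def \<tau>3_def fun_eq_iff\<close>)
  have 4: "runs (move_while (\<lambda>_. True) bk x) \<tau>3 (\<sigma>(r := ?zs)) (5 * n + 1)"
    by (rule runs_mono[OF runs_move_while])
       (use dist empty len in \<open>auto simp: \<tau>3_def fun_eq_iff\<close>)
  have "runs (add x r y c bk) \<sigma> (\<sigma>(r := ?zs)) (40 * n + 40)"
    unfolding add_def
    by (rule runs_mono[OF runs_Seq[OF 1 runs_Seq[OF 2 runs_Seq[OF 3 4]]] refl]) simp
  then show ?thesis using zs by (intro exI[of _ ?zs]) auto
qed

text \<open>Shift and add, from the least significant digit of \<open>q\<close> on: a zero pushed on
  \<open>x\<close> doubles it.\<close>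

definition mul :: "nat \<Rightarrow> nat \<Rightarrow> nat \<Rightarrow> nat \<Rightarrow> nat \<Rightarrow> nat \<Rightarrow> prog" where
  "mul x q r y c bk =
     Loop (\<lambda>v. v q \<noteq> None)
       (Cond (\<lambda>v. bit (v q)) (add x r y c bk) Skip ;; Push x (\<lambda>_. Digit False) ;; Pop q) ;;
     clear x"

text \<open>The value of \<open>r + x * q\<close> is invariant under a round. A round lengthens
  \<open>x\<close> by the new zero and \<open>r\<close> by at most a carry, while it shortens
  \<open>q\<close>, so \<open>n + length (\<sigma> q)\<close> is invariant as well and bounds all
  lengths.\<close>

lemma runs_mul:
  assumes dist: "distinct [x, q, r, y, c, bk]" and len: "length (\<sigma> x) \<le> n" "length (\<sigma> r) \<le> n"
    and empty: "\<sigma> y = []" "\<sigma> c = []" "\<sigma> bk = []"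
  shows "\<exists>zs. runs (mul x q r y c bk) \<sigma> (\<sigma>(x := [], q := [], r := zs))
      (length (\<sigma> q) * (40 * (n + length (\<sigma> q)) + 50) + 2 * (n + length (\<sigma> q)) + 3) \<and>
    length zs \<le> n + length (\<sigma> q) \<and> val zs = val (\<sigma> r) + val (\<sigma> x) * val (\<sigma> q)"
proof -
  let ?body = "Cond (\<lambda>v. bit (v q)) (add x r y c bk) Skip ;; Push x (\<lambda>_. Digit False) ;; Pop q"
  have loop: "\<exists>zs xs. runs (Loop (\<lambda>v. v q \<noteq> None) ?body) \<sigma> (\<sigma>(x := xs, q := [], r := zs))
      (length (\<sigma> q) * (40 * (n + length (\<sigma> q)) + 50) + 1) \<and>
      length zs \<le> n + length (\<sigma> q) \<and> length xs \<le> n + length (\<sigma> q) \<and>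
      val zs = val (\<sigma> r) + val (\<sigma> x) * val (\<sigma> q)"
    using len empty
  proof (induction "\<sigma> q" arbitrary: \<sigma> n)
    case Nil
    then show ?case
      by (intro exI[of _ "\<sigma> r"] exI[of _ "\<sigma> x"] conjI runs_mono[OF runs_Loop_stop])
         (auto simp: fun_eq_iff)
  next
    case (Cons d ds)
    obtain rs where rs: "runs (if d = Digit True then add x r y c bk else Skip) \<sigma> (\<sigma>(r := rs)) (40 * n + 40)"
      "length rs \<le> n + 1" "val rs = val (\<sigma> r) + (if d = Digit True then val (\<sigma> x) else 0)"
    proof (cases "d = Digit True")
      case True
      then show ?thesis
        using that runs_add[of x r y c bk \<sigma> n] Cons.prems dist by auto
    next
      case False
      have "runs Skip \<sigma> (\<sigma>(r := \<sigma> r)) (40 * n + 40)"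
        by (rule runs_mono[OF runs_loop_free]) auto
      then show ?thesis using that[of "\<sigma> r"] False Cons.prems by simp
    qed
    let ?p = "Push x (\<lambda>_. Digit False) ;; Pop q"
    define \<tau> where "\<tau> = \<sigma>(r := rs, x := Digit False # \<sigma> x, q := ds)"
    have 1: "runs (Cond (\<lambda>v. bit (v q)) (add x r y c bk) Skip) \<sigma> (\<sigma>(r := rs)) (40 * n + 41)"
      by (rule runs_mono[OF runs_Cond[where a = "40 * n + 40"] refl])
         (use rs(1) in \<open>simp_all flip: Cons.hyps(2)\<close>)
    have 2: "runs ?p (\<sigma>(r := rs)) \<tau> 4"
      by (rule runs_mono[OF runs_loop_free])
         (use dist in \<open>auto simp: \<tau>_def fun_eq_iff simp flip: Cons.hyps(2)\<close>)
    obtain zs xs where IH: "runs (Loop (\<lambda>v. v q \<noteq> None) ?body) \<tau> (\<tau>(x := xs, q := [], r := zs))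
        (length ds * (40 * (n + 1 + length ds) + 50) + 1)"
      "length zs \<le> n + 1 + length ds" "length xs \<le> n + 1 + length ds"
      "val zs = val (\<tau> r) + val (\<tau> x) * val (\<tau> q)"
      using Cons.hyps(1)[of \<tau> "n + 1"] Cons.prems rs(2) dist by (auto simp: \<tau>_def)
    have "runs (Loop (\<lambda>v. v q \<noteq> None) ?body) \<sigma> (\<sigma>(x := xs, q := [], r := zs))
        (length (\<sigma> q) * (40 * (n + length (\<sigma> q)) + 50) + 1)"
    proof (rule runs_mono[OF runs_Loop_step[OF _ runs_Seq[OF 1 2] IH(1)]])
      show "\<tau>(x := xs, q := [], r := zs) = \<sigma>(x := xs, q := [], r := zs)"
        using dist by (auto simp: \<tau>_def fun_eq_iff)
    qed (simp_all flip: Cons.hyps(2))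
    moreover have "val zs = val (\<sigma> r) + val (\<sigma> x) * val (\<sigma> q)"
      using IH(4) rs(3) dist by (auto simp: \<tau>_def algebra_simps simp flip: Cons.hyps(2))
    ultimately show ?case using IH(2,3)
      by (intro exI[of _ zs] exI[of _ xs]) (simp flip: Cons.hyps(2))
  qed
  then obtain zs xs where *: "runs (Loop (\<lambda>v. v q \<noteq> None) ?body) \<sigma> (\<sigma>(x := xs, q := [], r := zs))
      (length (\<sigma> q) * (40 * (n + length (\<sigma> q)) + 50) + 1)"
    "length zs \<le> n + length (\<sigma> q)" "length xs \<le> n + length (\<sigma> q)"
    "val zs = val (\<sigma> r) + val (\<sigma> x) * val (\<sigma> q)"
    by blast
  have "runs (mul x q r y c bk) \<sigma> (\<sigma>(x := [], q := [], r := zs))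
      (length (\<sigma> q) * (40 * (n + length (\<sigma> q)) + 50) + 2 * (n + length (\<sigma> q)) + 3)"
    unfolding mul_def
    by (rule runs_mono[OF runs_Seq[OF *(1) runs_clear]])
       (use dist *(3) in \<open>auto simp: fun_eq_iff\<close>)
  then show ?thesis using * by blast
qed

text \<open>The digits are compared from the least significant one on, so the last difference decides.
  A nonempty stack \<open>s\<close> reverses the comparison.\<close>

definition compare :: "nat \<Rightarrow> nat \<Rightarrow> nat \<Rightarrow> nat \<Rightarrow> prog" where
  "compare x y s g =
     Loop (\<lambda>v. v x \<noteq> None \<or> v y \<noteq> None)
       (Cond (\<lambda>v. bit (v x) = bit (v y)) Skip
          (Cond (\<lambda>v. bit (v x) \<noteq> (v s \<noteq> None)) (raise g) (Pop g)) ;;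
        Pop x ;; Pop y)"

text \<open>\<open>b\<close> is the verdict of the digits already read. All digits still to come are
  more significant, so it survives only if the remaining values are equal.\<close>

lemma runs_compare:
  assumes "distinct [x, y, s, g]" "length (\<sigma> x) \<le> n" "length (\<sigma> y) \<le> n" "\<sigma> g = flag b"
  shows "runs (compare x y s g) \<sigma>
    (\<sigma>(x := [], y := [], g := flag (if val (\<sigma> x) = val (\<sigma> y) then b
        else (val (\<sigma> x) > val (\<sigma> y)) \<noteq> (\<sigma> s \<noteq> [])))) (20 * n + 1)"
  using assms(2-)
proof (induction n arbitrary: \<sigma> b)
  case 0
  then show ?case unfolding compare_def
    by (intro runs_mono[OF runs_Loop_stop]) (auto simp: fun_eq_iff)
next
  case (Suc n)
  show ?case
  proof (cases "\<sigma> x = [] \<and> \<sigma> y = []")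
    case True
    then show ?thesis using Suc.prems unfolding compare_def
      by (intro runs_mono[OF runs_Loop_stop]) (auto simp: fun_eq_iff)
  next
    case False
    let ?p = "Cond (\<lambda>v. bit (v x) = bit (v y)) Skip
          (Cond (\<lambda>v. bit (v x) \<noteq> (v s \<noteq> None)) (raise g) (Pop g)) ;; Pop x ;; Pop y"
    let ?X = "bit (top_of (\<sigma> x))" and ?Y = "bit (top_of (\<sigma> y))"
    define b' where "b' = (if ?X = ?Y then b else ?X \<noteq> (\<sigma> s \<noteq> []))"
    define \<tau> where "\<tau> = \<sigma>(x := tl (\<sigma> x), y := tl (\<sigma> y), g := flag b')"
    have "result ?p \<sigma> = \<tau>"
      using assms(1) Suc.prems by (auto simp: \<tau>_def b'_def fun_eq_iff raised_apply)
    then have p: "runs ?p \<sigma> \<tau> 15" using runs_mono[OF runs_loop_free[of ?p \<sigma>]] by simp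
    have IH: "runs (compare x y s g) \<tau>
      (\<tau>(x := [], y := [], g := flag (if val (\<tau> x) = val (\<tau> y) then b'
        else (val (\<tau> x) > val (\<tau> y)) \<noteq> (\<tau> s \<noteq> [])))) (20 * n + 1)"
      by (rule Suc.IH) (use assms(1) Suc.prems in \<open>auto simp: \<tau>_def\<close>)
    have "(if val (\<tau> x) = val (\<tau> y) then b' else (val (\<tau> x) > val (\<tau> y)) \<noteq> (\<tau> s \<noteq> [])) =
      (if val (\<sigma> x) = val (\<sigma> y) then b else (val (\<sigma> x) > val (\<sigma> y)) \<noteq> (\<sigma> s \<noteq> []))"
    proof -
      have "val (\<sigma> x) = of_bool ?X + 2 * val (\<tau> x)" "val (\<sigma> y) = of_bool ?Y + 2 * val (\<tau> y)"
        using assms(1) val_unfold[of "\<sigma> x"] val_unfold[of "\<sigma> y"] by (simp_all add: \<tau>_def)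
      moreover have "\<tau> s = \<sigma> s" using assms(1) by (auto simp: \<tau>_def)
      ultimately show ?thesis by (cases ?X; cases ?Y) (auto simp: b'_def)
    qed
    then show ?thesis unfolding compare_def
      by (intro runs_mono[OF runs_Loop_step[OF _ p IH[unfolded compare_def]]])
         (use False assms(1) in \<open>auto simp: \<tau>_def fun_eq_iff\<close>)
  qed
qed

text \<open>Compares texts and not values: a player is written in only one way. A stack that ends
  early counts as a difference.\<close>

definition differ :: "nat \<Rightarrow> nat \<Rightarrow> nat \<Rightarrow> prog" where
  "differ x y g =
     Loop (\<lambda>v. v x \<noteq> None \<or> v y \<noteq> None)
       (Cond (\<lambda>v. v x = v y) Skip (raise g) ;; Pop x ;; Pop y)"

lemma runs_differ:
  assumes "distinct [x, y, g]" "length (\<sigma> x) \<le> n" "length (\<sigma> y) \<le> n" "\<sigma> g = flag b"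
  shows "runs (differ x y g) \<sigma> (\<sigma>(x := [], y := [], g := flag (b \<or> \<sigma> x \<noteq> \<sigma> y))) (20 * n + 1)"
  using assms(2-)
proof (induction n arbitrary: \<sigma> b)
  case 0
  then show ?case unfolding differ_def
    by (intro runs_mono[OF runs_Loop_stop]) (auto simp: fun_eq_iff)
next
  case (Suc n)
  show ?case
  proof (cases "\<sigma> x = [] \<and> \<sigma> y = []")
    case True
    then show ?thesis using Suc.prems unfolding differ_def
      by (intro runs_mono[OF runs_Loop_stop]) (auto simp: fun_eq_iff)
  next
    case False
    let ?p = "Cond (\<lambda>v. v x = v y) Skip (raise g) ;; Pop x ;; Pop y"
    define b' where "b' = (b \<or> top_of (\<sigma> x) \<noteq> top_of (\<sigma> y))"
    define \<tau> where "\<tau> = \<sigma>(x := tl (\<sigma> x), y := tl (\<sigma> y), g := flag b')"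
    have "result ?p \<sigma> = \<tau>"
      using assms(1) Suc.prems by (auto simp: \<tau>_def b'_def fun_eq_iff raised_apply)
    then have p: "runs ?p \<sigma> \<tau> 15" using runs_mono[OF runs_loop_free[of ?p \<sigma>]] by simp
    have IH: "runs (differ x y g) \<tau> (\<tau>(x := [], y := [], g := flag (b' \<or> \<tau> x \<noteq> \<tau> y))) (20 * n + 1)"
      by (rule Suc.IH) (use assms(1) Suc.prems in \<open>auto simp: \<tau>_def\<close>)
    have "(b' \<or> \<tau> x \<noteq> \<tau> y) = (b \<or> \<sigma> x \<noteq> \<sigma> y)"
      using assms(1) by (cases "\<sigma> x"; cases "\<sigma> y") (auto simp: b'_def \<tau>_def)
    then show ?thesis unfolding differ_def
      by (intro runs_mono[OF runs_Loop_step[OF _ p IH[unfolded differ_def]]])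
         (use False assms(1) in \<open>auto simp: \<tau>_def fun_eq_iff\<close>)
  qed
qed

section \<open>Comparing two entries\<close>

text \<open>This and the following functions are the parts of an entry \<open>b:p/q\<close>, with an
  optional minus sign before \<open>p\<close>. They are total on letter sequences and mirror the
  cuts made by \<open>parse\<close>.\<close>

definition key :: "letter list \<Rightarrow> letter list" where
  "key e = takeWhile (\<lambda>c. c \<noteq> Colon) e"

definition amount :: "letter list \<Rightarrow> letter list" where
  "amount e = tl (dropWhile (\<lambda>c. c \<noteq> Colon) e)"

definition negative :: "letter list \<Rightarrow> bool" where
  "negative e \<longleftrightarrow> top_of (amount e) = Some Minus"

definition magnitude :: "letter list \<Rightarrow> letter list" where
  "magnitude e = (if negative e then tl (amount e) else amount e)"

definition numer :: "letter list \<Rightarrow> letter list" where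
  "numer e = takeWhile (\<lambda>c. c \<noteq> Slash) (magnitude e)"

definition denom :: "letter list \<Rightarrow> letter list" where
  "denom e = takeWhile (\<lambda>c. c \<noteq> Colon) (tl (dropWhile (\<lambda>c. c \<noteq> Slash) (magnitude e)))"

text \<open>Every part ends up reversed, so numbers have their least significant digit on top. The
  entry itself is restored from \<open>bk\<close>, since the one on stack 8 is compared with many
  others.\<close>

definition parse :: "nat \<Rightarrow> nat \<Rightarrow> nat \<Rightarrow> nat \<Rightarrow> nat \<Rightarrow> nat \<Rightarrow> prog" where
  "parse e bk b s p q =
     copy_while (\<lambda>c. c \<noteq> Colon) e bk b ;; hop e bk ;;
     Cond (\<lambda>v. v e = Some Minus) (Push s (\<lambda>_. Minus) ;; hop e bk) Skip ;;
     copy_while (\<lambda>c. c \<noteq> Slash) e bk p ;; hop e bk ;;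
     copy_while (\<lambda>c. c \<noteq> Colon) e bk q ;;
     move_while (\<lambda>_. True) bk e"

lemma runs_parse:
  assumes dist: "distinct [e, bk, b, s, p, q]"
    and empty: "\<sigma> bk = []" "\<sigma> b = []" "\<sigma> s = []" "\<sigma> p = []" "\<sigma> q = []" and len: "length (\<sigma> e) \<le> n"
  shows "runs (parse e bk b s p q) \<sigma>
    (\<sigma>(b := rev (key (\<sigma> e)), s := (if negative (\<sigma> e) then [Minus] else []),
       p := rev (numer (\<sigma> e)), q := rev (denom (\<sigma> e)))) (40 * n + 50)"
proof -
  let ?e = "\<sigma> e"
  \<comment> \<open>\<open>X1\<close>, \<open>X4\<close> and \<open>X6\<close> are what remains on
    \<open>e\<close> after each cut; \<open>Y2\<close>, \<open>Y3\<close> and \<open>Y5\<close> are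
    the prefixes passed over, which lie reversed on \<open>bk\<close>.\<close>
  define X1 where "X1 = dropWhile (\<lambda>c. c \<noteq> Colon) ?e"
  define Y2 where "Y2 = key ?e @ take 1 X1"
  define Y3 where "Y3 = (if negative ?e then Y2 @ [Minus] else Y2)"
  define X4 where "X4 = dropWhile (\<lambda>c. c \<noteq> Slash) (magnitude ?e)"
  define Y5 where "Y5 = Y3 @ numer ?e @ take 1 X4"
  define X6 where "X6 = dropWhile (\<lambda>c. c \<noteq> Colon) (tl X4)"
  have split: "xs = take 1 xs @ tl xs" for xs :: "letter list" by (cases xs) auto
  have e1: "?e = key ?e @ X1" by (simp add: key_def X1_def)
  have e2: "?e = Y2 @ amount ?e"
    using e1 split[of X1] by (simp add: Y2_def amount_def X1_def)
  have "amount ?e = (if negative ?e then Minus # magnitude ?e else magnitude ?e)"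
    by (cases "amount ?e") (auto simp: negative_def magnitude_def)
  then have e3: "?e = Y3 @ magnitude ?e" using e2 by (auto simp: Y3_def)
  have "magnitude ?e = numer ?e @ X4" by (simp add: numer_def X4_def)
  then have e5: "?e = Y5 @ tl X4" using e3 split[of X4] by (simp add: Y5_def)
  have e6: "?e = Y5 @ denom ?e @ X6"
    using e5 by (simp add: denom_def X6_def X4_def)
  have lens: "length (key ?e) \<le> n" "length (numer ?e) \<le> n" "length (denom ?e) \<le> n"
      "length (Y5 @ denom ?e) \<le> n"
    using len arg_cong[OF e1, of length] arg_cong[OF e6, of length] by (simp_all add: Y5_def)
  define K S M N D where "K = key ?e" and "S = (if negative ?e then [Minus] else [])"
    and "M = magnitude ?e" and "N = numer ?e" and "D = denom ?e"
  note defs = K_def S_def M_def N_def D_def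
  have X1: "takeWhile (\<lambda>c. c \<noteq> Colon) ?e = K" "dropWhile (\<lambda>c. c \<noteq> Colon) ?e = X1"
    by (simp_all add: defs X1_def key_def)
  have X4: "takeWhile (\<lambda>c. c \<noteq> Slash) M = N" "dropWhile (\<lambda>c. c \<noteq> Slash) M = X4"
    by (simp_all add: defs X4_def numer_def)
  have X6: "takeWhile (\<lambda>c. c \<noteq> Colon) (tl X4) = D" "dropWhile (\<lambda>c. c \<noteq> Colon) (tl X4) = X6"
    by (simp_all add: defs X6_def X4_def denom_def)
  note lens = lens[folded defs]
  define \<sigma>1 where "\<sigma>1 = \<sigma>(e := X1, bk := rev K, b := rev K)"
  define \<sigma>2 where "\<sigma>2 = \<sigma>(e := amount ?e, bk := rev Y2, b := rev K)"
  define \<sigma>3 where "\<sigma>3 = \<sigma>(e := M, bk := rev Y3, b := rev K, s := S)"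
  define \<sigma>4 where "\<sigma>4 = \<sigma>(e := X4, bk := rev (Y3 @ N), b := rev K, s := S, p := rev N)"
  define \<sigma>5 where "\<sigma>5 = \<sigma>(e := tl X4, bk := rev Y5, b := rev K, s := S, p := rev N)"
  define \<sigma>6 where "\<sigma>6 = \<sigma>(e := X6, bk := rev (Y5 @ D), b := rev K, s := S, p := rev N, q := rev D)"
  have 1: "runs (copy_while (\<lambda>c. c \<noteq> Colon) e bk b) \<sigma> \<sigma>1 (8 * n + 1)"
    by (rule runs_mono[OF runs_copy_while]) (use dist empty lens in \<open>auto simp: \<sigma>1_def X1\<close>)
  have amount: "amount ?e = tl X1" by (simp add: amount_def X1_def)
  have 2: "runs (hop e bk) \<sigma>1 \<sigma>2 6"
  proof (rule runs_mono[OF runs_loop_free])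
    show "result (hop e bk) \<sigma>1 = \<sigma>2"
      by (cases X1) (use dist in \<open>auto simp: \<sigma>1_def \<sigma>2_def amount Y2_def K_def fun_eq_iff result_hop\<close>)
  qed simp_all
  have 3: "runs (Cond (\<lambda>v. v e = Some Minus) (Push s (\<lambda>_. Minus) ;; hop e bk) Skip) \<sigma>2 \<sigma>3 11"
    (is "runs ?p _ _ _")
  proof (rule runs_mono[OF runs_loop_free])
    show "result ?p \<sigma>2 = \<sigma>3"
    proof (cases "negative ?e")
      case True
      then obtain r where "amount ?e = Minus # r" by (cases "amount ?e") (auto simp: negative_def)
      then have "amount ?e = Minus # r" "S = [Minus]" "M = r" "Y3 = Y2 @ [Minus]"
        using True by (simp_all add: defs magnitude_def Y3_def)
      then show ?thesis
        using dist empty(3) by (auto simp: \<sigma>2_def \<sigma>3_def fun_eq_iff result_hop)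
    next
      case False
      then have "top_of (amount ?e) \<noteq> Some Minus" "S = []" "M = amount ?e" "Y3 = Y2"
        by (simp_all add: defs negative_def magnitude_def Y3_def)
      then show ?thesis
        using dist empty(3) by (auto simp: \<sigma>2_def \<sigma>3_def fun_eq_iff)
    qed
  qed simp_all
  have 4: "runs (copy_while (\<lambda>c. c \<noteq> Slash) e bk p) \<sigma>3 \<sigma>4 (8 * n + 1)"
    by (rule runs_mono[OF runs_copy_while])
       (use dist empty lens in \<open>auto simp: \<sigma>3_def \<sigma>4_def X4 fun_eq_iff\<close>)
  have 5: "runs (hop e bk) \<sigma>4 \<sigma>5 6"
  proof (rule runs_mono[OF runs_loop_free])
    show "result (hop e bk) \<sigma>4 = \<sigma>5"
      by (cases X4) (use dist in \<open>auto simp: \<sigma>4_def \<sigma>5_def Y5_def N_def fun_eq_iff result_hop\<close>)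
  qed simp_all
  have 6: "runs (copy_while (\<lambda>c. c \<noteq> Colon) e bk q) \<sigma>5 \<sigma>6 (8 * n + 1)"
    by (rule runs_mono[OF runs_copy_while])
       (use dist empty lens in \<open>auto simp: \<sigma>5_def \<sigma>6_def X6 fun_eq_iff\<close>)
  have "?e = Y5 @ D @ X6" using e6 by (simp add: defs)
  then have 7: "runs (move_while (\<lambda>_. True) bk e) \<sigma>6
    (\<sigma>(b := rev K, s := S, p := rev N, q := rev D)) (5 * n + 1)"
    by (intro runs_mono[OF runs_move_while])
       (use dist empty lens in \<open>auto simp: \<sigma>6_def fun_eq_iff\<close>)
  show ?thesis unfolding parse_def defs[symmetric]
    by (rule runs_mono[OF runs_Seq[OF 1 runs_Seq[OF 2 runs_Seq[OF 3 runs_Seq[OF 4 runs_Seq[OF 5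
          runs_Seq[OF 6 7]]]]]] refl]) simp
qed

text \<open>Cross multiplication of absolute values, with the order reversed between negative
  numbers. The condition \<open>e \<noteq> []\<close> excludes the match of two empty segments,
  which have equal keys and amounts.\<close>

definition le_entry :: "letter list \<Rightarrow> letter list \<Rightarrow> bool" where
  "le_entry e e' \<longleftrightarrow> e \<noteq> [] \<and> key e = key e' \<and>
     (let a = val (rev (numer e)) * val (rev (denom e')); b = val (rev (numer e')) * val (rev (denom e))
      in if negative e' then negative e \<and> b \<le> a else negative e \<or> a \<le> b)"

text \<open>Stacks 13 to 16 take the parts of the first entry, 17 to 20 those of the second, 21 and
  22 the cross products; 12, 23 and 24 are scratch, 25 and 26 flags. The sign on 14 reverses the
  comparison, so flag 26 refutes \<open>\<le>\<close> whenever the signs agree. All stacks but flag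
  27 get back their contents, as a loop body must guarantee.\<close>

definition test_entry :: prog where
  "test_entry =
     parse 8 12 13 14 15 16 ;; parse 10 12 17 18 19 20 ;;
     differ 13 17 25 ;; mul 15 20 21 23 24 12 ;; mul 19 16 22 23 24 12 ;;
     compare 21 22 14 26 ;;
     Cond (\<lambda>v. v 8 \<noteq> None \<and> v 25 = None \<and>
         (if v 18 = None then v 14 \<noteq> None \<or> v 26 = None else v 14 \<noteq> None \<and> v 26 = None))
       (raise 27) Skip ;;
     Pop 14 ;; Pop 18 ;; Pop 25 ;; Pop 26"

lemma length_parts:
  "length (key e) \<le> length e" "length (numer e) \<le> length e" "length (denom e) \<le> length e"
proof -
  have tl: "length (tl xs) \<le> length xs" for xs :: "letter list" by simp
  show "length (key e) \<le> length e" by (simp add: key_def length_takeWhile_le)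
  have m: "length (magnitude e) \<le> length e"
  proof -
    have "length (amount e) \<le> length e"
      unfolding amount_def by (rule le_trans[OF tl length_dropWhile_le])
    from this le_trans[OF tl this] show ?thesis by (simp add: magnitude_def)
  qed
  then show "length (numer e) \<le> length e"
    unfolding numer_def using length_takeWhile_le le_trans by blast
  show "length (denom e) \<le> length e"
    unfolding denom_def using m tl length_takeWhile_le length_dropWhile_le le_trans by meson
qed

lemma runs_test_entry:
  assumes empty: "\<forall>i\<in>{12..26}. \<sigma> i = []" and len: "length (\<sigma> 8) \<le> n" "length (\<sigma> 10) \<le> n"
  shows "runs test_entry \<sigma> (raised 27 (le_entry (\<sigma> 8) (\<sigma> 10)) \<sigma>) (400 * (n + 1) ^ 2)"
proof -
  let ?e = "\<sigma> 8" and ?e' = "\<sigma> 10"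
  have emp: "\<sigma> 12 = []" "\<sigma> 13 = []" "\<sigma> 14 = []" "\<sigma> 15 = []" "\<sigma> 16 = []" "\<sigma> 17 = []" "\<sigma> 18 = []"
    "\<sigma> 19 = []" "\<sigma> 20 = []" "\<sigma> 21 = []" "\<sigma> 22 = []" "\<sigma> 23 = []" "\<sigma> 24 = []" "\<sigma> 25 = []" "\<sigma> 26 = []"
    using empty by simp_all
  let ?s = "if negative ?e then [Minus] else []" and ?s' = "if negative ?e' then [Minus] else []"
  have parts: "length (key ?e) \<le> n" "length (numer ?e) \<le> n" "length (denom ?e) \<le> n"
    "length (key ?e') \<le> n" "length (numer ?e') \<le> n" "length (denom ?e') \<le> n"
    using length_parts[of ?e] length_parts[of ?e'] len by auto
  define a where "a = val (rev (numer ?e)) * val (rev (denom ?e'))"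
  define b where "b = val (rev (numer ?e')) * val (rev (denom ?e))"
  define \<sigma>1 where "\<sigma>1 = \<sigma>(13 := rev (key ?e), 14 := ?s, 15 := rev (numer ?e), 16 := rev (denom ?e))"
  define \<sigma>2 where "\<sigma>2 = \<sigma>1(17 := rev (key ?e'), 18 := ?s', 19 := rev (numer ?e'), 20 := rev (denom ?e'))"
  define \<sigma>3 where "\<sigma>3 = \<sigma>2(13 := [], 17 := [], 25 := flag (key ?e \<noteq> key ?e'))"
  have 1: "runs (parse 8 12 13 14 15 16) \<sigma> \<sigma>1 (40 * n + 50)"
    unfolding \<sigma>1_def by (rule runs_parse) (use emp len in auto)
  have 2: "runs (parse 10 12 17 18 19 20) \<sigma>1 \<sigma>2 (40 * n + 50)"
    by (rule runs_mono[OF runs_parse[where n = n]]) (use emp len in \<open>auto simp: \<sigma>1_def \<sigma>2_def\<close>)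
  have 3: "runs (differ 13 17 25) \<sigma>2 \<sigma>3 (20 * n + 1)"
    by (rule runs_mono[OF runs_differ[where n = n and b = False]])
       (use emp parts in \<open>auto simp: \<sigma>1_def \<sigma>2_def \<sigma>3_def\<close>)
  \<comment> \<open>The time of \<open>mul\<close> on operands of length \<open>n\<close>, whose
    products have length at most \<open>2 * n\<close>; it is the only quadratic contribution to the
    bound.\<close>
  define m where "m = n * (40 * (n + n) + 50) + 2 * (n + n) + 3"
  have mono: "k * (40 * (n + k) + 50) + 2 * (n + k) + 3 \<le> m" if "k \<le> n" for k
    unfolding m_def using that by (intro add_mono mult_mono) auto
  have "\<exists>zs. runs (mul 15 20 21 23 24 12) \<sigma>3 (\<sigma>3(15 := [], 20 := [], 21 := zs))
      (length (\<sigma>3 20) * (40 * (n + length (\<sigma>3 20)) + 50) + 2 * (n + length (\<sigma>3 20)) + 3) \<and>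
    length zs \<le> n + length (\<sigma>3 20) \<and> val zs = val (\<sigma>3 21) + val (\<sigma>3 15) * val (\<sigma>3 20)"
    by (rule runs_mul) (use emp parts in \<open>auto simp: \<sigma>1_def \<sigma>2_def \<sigma>3_def\<close>)
  moreover have "\<sigma>3 20 = rev (denom ?e')" "\<sigma>3 21 = []" "\<sigma>3 15 = rev (numer ?e)"
    using emp by (simp_all add: \<sigma>1_def \<sigma>2_def \<sigma>3_def)
  ultimately obtain xs where xs: "runs (mul 15 20 21 23 24 12) \<sigma>3 (\<sigma>3(15 := [], 20 := [], 21 := xs)) m"
    "length xs \<le> 2 * n" "val xs = a"
    using runs_mono[OF _ refl mono] parts by (fastforce simp: a_def)
  define \<sigma>4 where "\<sigma>4 = \<sigma>3(15 := [], 20 := [], 21 := xs)"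
  have "\<exists>zs. runs (mul 19 16 22 23 24 12) \<sigma>4 (\<sigma>4(19 := [], 16 := [], 22 := zs))
      (length (\<sigma>4 16) * (40 * (n + length (\<sigma>4 16)) + 50) + 2 * (n + length (\<sigma>4 16)) + 3) \<and>
    length zs \<le> n + length (\<sigma>4 16) \<and> val zs = val (\<sigma>4 22) + val (\<sigma>4 19) * val (\<sigma>4 16)"
    by (rule runs_mul) (use emp parts in \<open>auto simp: \<sigma>1_def \<sigma>2_def \<sigma>3_def \<sigma>4_def\<close>)
  moreover have "\<sigma>4 16 = rev (denom ?e)" "\<sigma>4 22 = []" "\<sigma>4 19 = rev (numer ?e')"
    using emp by (simp_all add: \<sigma>1_def \<sigma>2_def \<sigma>3_def \<sigma>4_def)
  ultimately obtain ys where ys: "runs (mul 19 16 22 23 24 12) \<sigma>4 (\<sigma>4(19 := [], 16 := [], 22 := ys)) m"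
    "length ys \<le> 2 * n" "val ys = b"
    using runs_mono[OF _ refl mono] parts by (fastforce simp: b_def)
  define \<sigma>5 where "\<sigma>5 = \<sigma>4(19 := [], 16 := [], 22 := ys)"
  define \<sigma>6 where "\<sigma>6 = \<sigma>5(21 := [], 22 := [],
    26 := flag (if a = b then False else (a > b) \<noteq> negative ?e))"
  have 6: "runs (compare 21 22 14 26) \<sigma>5 \<sigma>6 (20 * (2 * n) + 1)"
    by (rule runs_mono[OF runs_compare[where n = "2 * n" and b = False]])
       (use emp xs ys in \<open>auto simp: \<sigma>1_def \<sigma>2_def \<sigma>3_def \<sigma>4_def \<sigma>5_def \<sigma>6_def\<close>)
  let ?p = "Cond (\<lambda>v. v 8 \<noteq> None \<and> v 25 = None \<and>
         (if v 18 = None then v 14 \<noteq> None \<or> v 26 = None else v 14 \<noteq> None \<and> v 26 = None))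
       (raise 27) Skip ;; Pop 14 ;; Pop 18 ;; Pop 25 ;; Pop 26"
  have \<sigma>6: "\<sigma>6 = \<sigma>(14 := ?s, 18 := ?s', 25 := flag (key ?e \<noteq> key ?e'),
      26 := flag (if a = b then False else (a > b) \<noteq> negative ?e))"
    using emp by (auto simp: \<sigma>1_def \<sigma>2_def \<sigma>3_def \<sigma>4_def \<sigma>5_def \<sigma>6_def fun_eq_iff)
  have test: "le_entry ?e ?e' \<longleftrightarrow> ?e \<noteq> [] \<and> key ?e = key ?e' \<and>
      (if negative ?e' then negative ?e \<and> b \<le> a else negative ?e \<or> a \<le> b)"
    by (simp add: le_entry_def a_def b_def Let_def)
  have 7: "runs ?p \<sigma>6 (raised 27 (le_entry ?e ?e') \<sigma>) 20"
    by (rule runs_mono[OF runs_loop_free])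
       (use emp in \<open>auto simp: \<sigma>6 test fun_eq_iff raised_apply\<close>)
  show ?thesis unfolding test_entry_def
    by (rule runs_mono[OF runs_Seq[OF 1 runs_Seq[OF 2 runs_Seq[OF 3 runs_Seq[OF
          xs(1)[folded \<sigma>4_def] runs_Seq[OF ys(1)[folded \<sigma>5_def] runs_Seq[OF 6 7]]]]]] refl])
       (simp add: m_def power2_eq_square algebra_simps)
qed

section \<open>The decision program\<close>

text \<open>Passes the negated flag of an inner existential loop to the loop outside and lowers the
  inner flag for the next round. Two such negations produce the \<open>\<forall>\<close> over
  \<open>w\<close> inside the \<open>\<exists>\<close> over \<open>u\<close>.\<close>

definition raise_unless :: "nat \<Rightarrow> nat \<Rightarrow> prog" where
  "raise_unless g f = Cond (\<lambda>v. v g = None) (raise f) (Pop g)"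

lemma runs_raise_unless:
  assumes "runs p \<sigma> (raised g b \<sigma>) T" "\<sigma> g = []" "f \<noteq> g"
  shows "runs (p ;; raise_unless g f) \<sigma> (raised f (\<not> b) \<sigma>) (T + 7)"
  unfolding raise_unless_def
  by (rule runs_mono[OF runs_Seq[OF assms(1) runs_loop_free]])
     (use assms(2,3) in \<open>auto simp: fun_eq_iff raised_def\<close>)

text \<open>Stack 2 holds the outcomes and stack 3 the outcomes preceded by the pairs of \<open>W\<close>; the current
  element of each is kept, reversed, on stacks 4 and 6. Stacks 8 and 10 hold the current entries of
  stacks 6 and 4. Levels 4 and 3 raise the flag 27, level 2 raises 28 and level 1 raises 29.\<close>

definition level4 :: prog where "level4 = each_segment Comma 4 10 11 test_entry"
definition level3 :: prog where "level3 = each_segment Comma 6 8 9 level4"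
definition level2 :: prog where
  "level2 = each_segment Semicolon 3 6 7 (level3 ;; raise_unless 27 28)"
definition level1 :: prog where
  "level1 = each_segment Semicolon 2 4 5 (level2 ;; raise_unless 28 29)"

text \<open>Both arguments are segments in reverse order.\<close>

definition meets :: "letter list \<Rightarrow> letter list \<Rightarrow> bool" where
  "meets w u \<longleftrightarrow> (\<exists>s\<in>set (segs Comma w). \<exists>s'\<in>set (segs Comma u). le_entry (rev s) (rev s'))"

lemma length_segs: "s \<in> set (segs d xs) \<Longrightarrow> length s \<le> length xs"
proof (induction d xs rule: segs.induct)
  case (2 d x xs)
  have "length (tl (dropWhile (\<lambda>c. c \<noteq> d) (x # xs))) \<le> length (x # xs)"
    using length_dropWhile_le[of "\<lambda>c. c \<noteq> d" "x # xs"] by simp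
  moreover have "length (takeWhile (\<lambda>c. c \<noteq> d) (x # xs)) \<le> length (x # xs)"
    by (rule length_takeWhile_le)
  ultimately show ?case using 2 le_trans by (auto simp del: takeWhile.simps dropWhile.simps)
qed simp

lemma runs_level4:
  assumes "\<forall>i\<in>{10..26}. \<sigma> i = []" "length (\<sigma> 8) \<le> n" "length (\<sigma> 4) \<le> n"
  shows "runs level4 \<sigma> (raised 27 (\<exists>s\<in>set (segs Comma (\<sigma> 4)). le_entry (\<sigma> 8) (rev s)) \<sigma>)
    ((400 * (n + 1) ^ 2 + 40) * n + 3)"
proof -
  have "runs test_entry \<tau> (raised 27 (le_entry (\<sigma> 8) (rev s)) \<tau>) (400 * (n + 1) ^ 2)"
    if "s \<in> set (segs Comma (\<sigma> 4))" "\<And>i. i \<notin> {4, 10, 11, 27} \<Longrightarrow> \<tau> i = \<sigma> i" "\<tau> 10 = rev s" for s \<tau>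
    using runs_test_entry[of \<tau> n] that assms length_segs[OF that(1)] by simp
  then show ?thesis unfolding level4_def
    by (intro runs_mono[OF runs_each_segment[where n = n and f = 27 and T = "400 * (n + 1) ^ 2"
          and P = "\<lambda>s. le_entry (\<sigma> 8) (rev s)"]]) (use assms in \<open>auto simp: ac_simps\<close>)
qed

lemma runs_level3:
  assumes "\<forall>i\<in>{8..26}. \<sigma> i = []" "length (\<sigma> 6) \<le> n" "length (\<sigma> 4) \<le> n"
  shows "runs level3 \<sigma> (raised 27 (meets (\<sigma> 6) (\<sigma> 4)) \<sigma>)
    (((400 * (n + 1) ^ 2 + 40) * n + 43) * n + 3)"
proof -
  have "runs level4 \<tau> (raised 27 (\<exists>s'\<in>set (segs Comma (\<sigma> 4)). le_entry (rev s) (rev s')) \<tau>)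
      ((400 * (n + 1) ^ 2 + 40) * n + 3)"
    if "s \<in> set (segs Comma (\<sigma> 6))" "\<And>i. i \<notin> {6, 8, 9, 27} \<Longrightarrow> \<tau> i = \<sigma> i" "\<tau> 8 = rev s" for s \<tau>
    using runs_level4[of \<tau> n] that assms length_segs[OF that(1)] by simp
  then show ?thesis unfolding level3_def meets_def
    by (intro runs_mono[OF runs_each_segment[where n = n and f = 27
          and T = "(400 * (n + 1) ^ 2 + 40) * n + 3"
          and P = "\<lambda>s. \<exists>s'\<in>set (segs Comma (\<sigma> 4)). le_entry (rev s) (rev s')"]]) (use assms in \<open>auto simp: ac_simps\<close>)
qed

text \<open>Flag 28 may already be up from an earlier round of \<open>level2\<close>, so it is not
  among the stacks assumed empty. Flag 27 is, because \<open>raise_unless\<close> lowers it each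
  time.\<close>

lemma runs_level2:
  assumes "\<forall>i\<in>{6..27}. \<sigma> i = []" "length (\<sigma> 3) \<le> n" "length (\<sigma> 4) \<le> n"
  shows "runs level2 \<sigma> (raised 28 (\<exists>w\<in>set (segs Semicolon (\<sigma> 3)). \<not> meets (rev w) (\<sigma> 4)) \<sigma>)
    ((((400 * (n + 1) ^ 2 + 40) * n + 43) * n + 50) * n + 3)"
proof -
  have "runs (level3 ;; raise_unless 27 28) \<tau> (raised 28 (\<not> meets (rev w) (\<sigma> 4)) \<tau>)
      (((400 * (n + 1) ^ 2 + 40) * n + 43) * n + 3 + 7)"
    if "w \<in> set (segs Semicolon (\<sigma> 3))" "\<And>i. i \<notin> {3, 6, 7, 28} \<Longrightarrow> \<tau> i = \<sigma> i" "\<tau> 6 = rev w" for w \<tau>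
    by (rule runs_raise_unless)
       (use runs_level3[of \<tau> n] that assms length_segs[OF that(1)] in auto)
  then show ?thesis unfolding level2_def
    by (intro runs_mono[OF runs_each_segment[where n = n and f = 28
          and T = "((400 * (n + 1) ^ 2 + 40) * n + 43) * n + 3 + 7"
          and P = "\<lambda>w. \<not> meets (rev w) (\<sigma> 4)"]]) (use assms in \<open>auto simp: ac_simps\<close>)
qed

lemma runs_level1:
  assumes "\<forall>i\<in>{4..28}. \<sigma> i = []" "length (\<sigma> 2) \<le> n" "length (\<sigma> 3) \<le> n"
  shows "runs level1 \<sigma>
    (raised 29 (\<exists>u\<in>set (segs Semicolon (\<sigma> 2)). \<forall>w\<in>set (segs Semicolon (\<sigma> 3)).
      meets (rev w) (rev u)) \<sigma>)
    (((((400 * (n + 1) ^ 2 + 40) * n + 43) * n + 50) * n + 50) * n + 3)"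
proof -
  have "runs (level2 ;; raise_unless 28 29) \<tau>
      (raised 29 (\<not> (\<exists>w\<in>set (segs Semicolon (\<sigma> 3)). \<not> meets (rev w) (rev u))) \<tau>)
      ((((400 * (n + 1) ^ 2 + 40) * n + 43) * n + 50) * n + 3 + 7)"
    if "u \<in> set (segs Semicolon (\<sigma> 2))" "\<And>i. i \<notin> {2, 4, 5, 29} \<Longrightarrow> \<tau> i = \<sigma> i" "\<tau> 4 = rev u" for u \<tau>
    by (rule runs_raise_unless)
       (use runs_level2[of \<tau> n] that assms length_segs[OF that(1)] in auto)
  then show ?thesis unfolding level1_def
    by (intro runs_mono[OF runs_each_segment[where n = n and f = 29
          and T = "(((400 * (n + 1) ^ 2 + 40) * n + 43) * n + 50) * n + 3 + 7"
          and P = "\<lambda>u. \<not> (\<exists>w\<in>set (segs Semicolon (\<sigma> 3)). \<not> meets (rev w) (rev u))"]])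
       (use assms in \<open>auto simp: ac_simps\<close>)
qed

text \<open>Incomplete letters at the end of the input are padded with \<open>Bar\<close>.\<close>

definition letter_of :: "letter \<Rightarrow> letter \<Rightarrow> letter \<Rightarrow> letter" where
  "letter_of a b c = (SOME l. map Digit (letter_code l) = [a, b, c])"

fun decode :: "letter list \<Rightarrow> letter list" where
  "decode [] = []"
| "decode [a] = [letter_of a Bar Bar]"
| "decode [a, b] = [letter_of a b Bar]"
| "decode (a # b # c # xs) = letter_of a b c # decode xs"

text \<open>Stacks 4 to 6 serve as registers for the three bits and are empty again before
  \<open>level1\<close> starts.\<close>

definition decode_step :: prog where
  "decode_step =
     (let read = (\<lambda>v. case v 0 of None \<Rightarrow> Bar | Some c \<Rightarrow> c) in
      Push 4 read ;; Pop 0 ;; Push 5 read ;; Pop 0 ;; Push 6 read ;; Pop 0 ;;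
      Push 1 (\<lambda>v. letter_of (the (v 4)) (the (v 5)) (the (v 6))) ;; Pop 4 ;; Pop 5 ;; Pop 6)"

text \<open>Decoding leaves the text on stack 1 with its end on top. Hence the outcomes come off
  first; moving them restores their order, and the pairs of \<open>W\<close> end up above the
  outcomes on stack 3.\<close>

definition core_program :: prog where
  "core_program =
     Loop (\<lambda>v. v 0 \<noteq> None) decode_step ;;
     copy_while (\<lambda>c. c \<noteq> Bar) 1 2 3 ;; Pop 1 ;; move_while (\<lambda>c. c \<noteq> Bar) 1 3 ;; level1"

section \<open>Decoding the input string\<close>

lemma letter_of_code [simp]:
  assumes "map Digit (letter_code l) = [a, b, c]"
  shows "letter_of a b c = l"
proof -
  have "k = l" if "map Digit (letter_code k) = map Digit (letter_code l)" for k
    using that by (cases k; cases l) auto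
  then show ?thesis
    unfolding letter_of_def assms[symmetric] by (metis (mono_tags, lifting) someI)
qed

lemma decode_encode: "decode (map Digit (concat (map letter_code ls))) = ls"
proof (induction ls)
  case (Cons l ls)
  obtain a b c where abc: "letter_code l = [a, b, c]" by (cases l) auto
  then show ?case using Cons letter_of_code[of l] by simp
qed simp

lemma length_decode: "length (decode xs) \<le> length xs"
  by (induction xs rule: decode.induct) auto

text \<open>Appending \<open>[Bar]\<close> gives \<open>hd\<close> the padding letter as its
  default.\<close>

lemma runs_decode_step:
  assumes "\<sigma> 4 = []" "\<sigma> 5 = []" "\<sigma> 6 = []" "\<sigma> 0 \<noteq> []"
  shows "runs decode_step \<sigma>
    (\<sigma>(0 := drop 3 (\<sigma> 0), 1 := letter_of (hd (\<sigma> 0)) (hd (drop 1 (\<sigma> 0) @ [Bar]))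
        (hd (drop 2 (\<sigma> 0) @ [Bar])) # \<sigma> 1)) 23"
proof -
  have "drop 3 xs = tl (tl (tl xs))" for xs :: "letter list" by (simp add: numeral_3_eq_3 drop_Suc)
  moreover have "(case top_of xs of None \<Rightarrow> Bar | Some c \<Rightarrow> c) = hd (xs @ [Bar])" for xs
    by (cases xs) auto
  moreover have "drop 1 xs = tl xs" "drop 2 xs = tl (tl xs)" for xs :: "letter list"
    by (simp_all add: drop_Suc numeral_2_eq_2)
  ultimately show ?thesis
    by (intro runs_mono[OF runs_loop_free])
       (use assms in \<open>auto simp: decode_step_def Let_def fun_eq_iff\<close>)
qed

lemma runs_decode:
  assumes "\<sigma> 4 = []" "\<sigma> 5 = []" "\<sigma> 6 = []"
  shows "runs (Loop (\<lambda>v. v 0 \<noteq> None) decode_step) \<sigma>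
    (\<sigma>(0 := [], 1 := rev (decode (\<sigma> 0)) @ \<sigma> 1)) (24 * length (\<sigma> 0) + 1)"
  using assms
proof (induction "\<sigma> 0" arbitrary: \<sigma> rule: decode.induct)
  case 1
  show ?case by (rule runs_mono[OF runs_Loop_stop]) (simp_all add: fun_eq_iff flip: 1(1))
next
  case (2 a)
  let ?\<tau> = "\<sigma>(0 := [], 1 := letter_of a Bar Bar # \<sigma> 1)"
  have "runs decode_step \<sigma> ?\<tau> 23"
    by (rule runs_mono[OF runs_decode_step]) (use 2(2-4) in \<open>simp_all flip: 2(1)\<close>)
  note it = runs_Loop_step[where c = "\<lambda>v. v 0 \<noteq> None", OF _ this runs_Loop_stop]
  show ?case by (rule runs_mono[OF it]) (simp_all add: fun_eq_iff flip: 2(1))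
next
  case (3 a b)
  let ?\<tau> = "\<sigma>(0 := [], 1 := letter_of a b Bar # \<sigma> 1)"
  have "runs decode_step \<sigma> ?\<tau> 23"
    by (rule runs_mono[OF runs_decode_step]) (use 3(2-4) in \<open>simp_all flip: 3(1)\<close>)
  note it = runs_Loop_step[where c = "\<lambda>v. v 0 \<noteq> None", OF _ this runs_Loop_stop]
  show ?case by (rule runs_mono[OF it]) (simp_all add: fun_eq_iff flip: 3(1))
next
  case (4 a b c xs)
  let ?\<tau> = "\<sigma>(0 := xs, 1 := letter_of a b c # \<sigma> 1)"
  have it: "runs decode_step \<sigma> ?\<tau> 23"
    by (rule runs_mono[OF runs_decode_step]) (use 4(3-5) in \<open>simp_all flip: 4(2)\<close>)
  have "runs (Loop (\<lambda>v. v 0 \<noteq> None) decode_step) ?\<tau>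
      (?\<tau>(0 := [], 1 := rev (decode (?\<tau> 0)) @ ?\<tau> 1)) (24 * length (?\<tau> 0) + 1)"
    by (rule 4(1)) (use 4(3-5) in simp_all)
  note it = runs_Loop_step[where c = "\<lambda>v. v 0 \<noteq> None", OF _ it this]
  show ?case by (rule runs_mono[OF it]) (simp_all add: fun_eq_iff flip: 4(2))
qed

text \<open>Cut at the last bar and not at the first, as the program reads the text from its
  end.\<close>

definition outcomes_text :: "letter list \<Rightarrow> letter list" where
  "outcomes_text ls = rev (takeWhile (\<lambda>c. c \<noteq> Bar) (rev ls))"

definition offers_text :: "letter list \<Rightarrow> letter list" where
  "offers_text ls =
     rev (takeWhile (\<lambda>c. c \<noteq> Bar) (tl (dropWhile (\<lambda>c. c \<noteq> Bar) (rev ls)))) @ outcomes_text ls"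

definition accepts :: "letter list \<Rightarrow> bool" where
  "accepts ls \<longleftrightarrow> (\<exists>u\<in>set (segs Semicolon (outcomes_text ls)).
     \<forall>w\<in>set (segs Semicolon (offers_text ls)). meets (rev w) (rev u))"

lemma runs_core_program:
  fixes x :: "bool list"
  defines "n \<equiv> length x"
  shows "\<exists>\<tau>. runs core_program (input_store x) \<tau>
      (((((400 * (n + 1) ^ 2 + 40) * n + 43) * n + 50) * n + 50) * n + 50 * n + 20) \<and>
    (\<tau> 29 \<noteq> [] \<longleftrightarrow> accepts (decode (map Digit x)))"
proof -
  let ?ls = "decode (map Digit x)"
  let ?z = "dropWhile (\<lambda>c. c \<noteq> Bar) (rev ?ls)"
  let ?\<sigma> = "input_store x"
  define \<sigma>1 where "\<sigma>1 = (\<lambda>_ :: nat. [])(1 := rev ?ls)"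
  define \<sigma>2 where "\<sigma>2 = (\<lambda>_ :: nat. [])(1 := ?z, 2 := outcomes_text ?ls, 3 := outcomes_text ?ls)"
  define \<sigma>3 where "\<sigma>3 = \<sigma>2(1 := tl ?z)"
  define \<sigma>4 where "\<sigma>4 = \<sigma>3(1 := dropWhile (\<lambda>c. c \<noteq> Bar) (tl ?z), 3 := offers_text ?ls)"
  have len: "length ?ls \<le> n" using length_decode[of "map Digit x"] by (simp add: n_def)
  have tw: "length (takeWhile (\<lambda>c. c \<noteq> Bar) (rev ?ls)) + length ?z = length ?ls"
    by (metis length_append length_rev takeWhile_dropWhile_id)
  have 1: "runs (Loop (\<lambda>v. v 0 \<noteq> None) decode_step) ?\<sigma> \<sigma>1 (24 * n + 1)"
    by (rule runs_mono[OF runs_decode]) (auto simp: input_store_def \<sigma>1_def n_def fun_eq_iff)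
  have 2: "runs (copy_while (\<lambda>c. c \<noteq> Bar) 1 2 3) \<sigma>1 \<sigma>2 (8 * n + 1)"
    by (rule runs_mono[OF runs_copy_while])
       (use len tw in \<open>auto simp: \<sigma>1_def \<sigma>2_def outcomes_text_def fun_eq_iff\<close>)
  have 3: "runs (Pop 1) \<sigma>2 \<sigma>3 1"
    by (rule runs_mono[OF runs_loop_free]) (auto simp: \<sigma>2_def \<sigma>3_def)
  have 4: "runs (move_while (\<lambda>c. c \<noteq> Bar) 1 3) \<sigma>3 \<sigma>4 (5 * n + 1)"
    by (rule runs_mono[OF runs_move_while])
       (use len tw in \<open>auto simp: \<sigma>2_def \<sigma>3_def \<sigma>4_def offers_text_def fun_eq_iff\<close>)
  have "length (takeWhile (\<lambda>c. c \<noteq> Bar) (tl ?z)) \<le> length ?z"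
    using length_takeWhile_le[of "\<lambda>c. c \<noteq> Bar" "tl ?z"] by simp
  then have "length (offers_text ?ls) \<le> n" "length (outcomes_text ?ls) \<le> n"
    using len tw by (simp_all add: offers_text_def outcomes_text_def)
  then have 5: "runs level1 \<sigma>4 (raised 29 (accepts ?ls) \<sigma>4)
      (((((400 * (n + 1) ^ 2 + 40) * n + 43) * n + 50) * n + 50) * n + 3)"
    using runs_level1[of \<sigma>4 n] by (simp add: accepts_def \<sigma>2_def \<sigma>3_def \<sigma>4_def)
  have "runs core_program (input_store x) (raised 29 (accepts ?ls) \<sigma>4)
      (((((400 * (n + 1) ^ 2 + 40) * n + 43) * n + 50) * n + 50) * n + 50 * n + 20)"
    unfolding core_program_def
    by (rule runs_mono[OF runs_Seq[OF 1 runs_Seq[OF 2 runs_Seq[OF 3 runs_Seq[OF 4 5]]]] refl]) simp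
  then show ?thesis
    by (intro exI[of _ "raised 29 (accepts ?ls) \<sigma>4"])
       (simp add: raised_apply \<sigma>2_def \<sigma>3_def \<sigma>4_def)
qed

lemma pushes_below_core_program: "pushes_below 30 core_program"
  by (simp add: core_program_def decode_step_def Let_def level1_def level2_def level3_def level4_def
      each_segment_def copy_while_def move_while_def hop_def clear_def raise_def raise_unless_def
      test_entry_def parse_def differ_def mul_def add_def add_loop_def compare_def)

lemma accepts_decidable:
  "\<exists>M (P :: nat poly). turing_machine M \<and>
    (\<forall>x. state_after M x (poly P (length x)) =
      (if accepts (decode (map Digit x)) then accept M else reject M))"
proof -
  define X where "X = [:0, 1 :: nat:]"
  \<comment> \<open>The bound of \<open>runs_core_program\<close> in Horner form: each of the four
    nested loops contributes a factor \<open>X\<close>, the arithmetic of the innermost test a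
    quadratic one.\<close>
  define P where "P = (((([:400:] * (X + 1) ^ 2 + [:40:]) * X + [:43:]) * X + [:50:]) * X + [:50:]) * X
    + [:50:] * X + [:20:]"
  have P: "poly P n = ((((400 * (n + 1) ^ 2 + 40) * n + 43) * n + 50) * n + 50) * n + 50 * n + 20" for n
    by (simp add: P_def X_def algebra_simps power2_eq_square)
  show ?thesis
  proof (rule prog_decides[where k = 30 and p = core_program and P = P
        and verdict = "\<lambda>v. v 29 \<noteq> None", OF _ pushes_below_core_program])
    fix x :: "bool list"
    show "\<exists>t \<tau>. exec core_program (input_store x) t \<tau> \<and> t \<le> poly P (length x) \<and>
        (tops \<tau> 29 \<noteq> None \<longleftrightarrow> accepts (decode (map Digit x)))"
      using runs_core_program[of x] unfolding runs_def P by auto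
  qed simp
qed

section \<open>Correctness\<close>

text \<open>The right argument of \<open>(++)\<close> wins, so the innermost map keeps its values
  whatever is placed before it.\<close>

lemma foldr_map_add_last: "b \<in> dom m \<Longrightarrow> foldr (++) ms m b = m b"
  by (induction ms) (auto simp: map_add_def split: option.splits)

lemma valid_game_pair:
  assumes "valid_game A W VA" "(B, w) \<in> W"
  shows "coalition A B" "dom w = B"
proof -
  have "\<forall>(B, w)\<in>W. coalition A B \<and> dom w = B"
    using assms(1) by (simp add: valid_game_def concise_representation_def)
  from bspec[OF this assms(2)] show "coalition A B" "dom w = B" by simp_all
qed

text \<open>Removes the quantifier over coalitions: the right-hand side ranges over listed vectors
  only, an outcome being treated as a pair with coalition \<open>A\<close>.\<close>

lemma core_nonempty_iff:
  assumes valid: "valid_game A W VA"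
  shows "core A (possibility_set A W VA) \<noteq> {} \<longleftrightarrow>
    (\<exists>u\<in>VA. \<forall>p \<in> W \<union> Pair A ` VA. \<exists>b\<in>fst p. the (snd p b) \<le> the (u b))"
proof -
  let ?V = "possibility_set A W VA"
  define X where "X = W \<union> Pair A ` VA"
  have A: "coalition A A" and sub: "derived W A \<subseteq> VA"
    using valid by (simp_all add: valid_game_def concise_representation_def coalition_def)
  note W = valid_game_pair[OF valid]
  \<comment> \<open>A pair of \<open>W\<close> is the concatenation of a single block. For
    \<open>B = A\<close> the promise \<open>derived W A \<subseteq> VA\<close> makes it an
    outcome.\<close>
  have pair: "w \<in> ?V B" if "(B, w) \<in> W" for B w
  proof -
    have "w = foldr (++) (map snd [(B, w)]) Map.empty \<and> [(B, w)] \<noteq> [] \<and> set [(B, w)] \<subseteq> W \<and>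
        sorted_wrt (\<lambda>p q. fst p \<inter> fst q = {}) [(B, w)] \<and> \<Union> (fst ` set [(B, w)]) = B"
      using that by simp
    then have "w \<in> derived W B" unfolding derived_def mem_Collect_eq by (rule exI)
    then show ?thesis using sub by (auto simp: possibility_set_def)
  qed
  have "(\<exists>B. coalition A B \<and> blocks ?V B u) \<longleftrightarrow> (\<exists>p\<in>X. \<forall>b\<in>fst p. the (snd p b) > the (u b))" for u
  proof
    assume "\<exists>B. coalition A B \<and> blocks ?V B u"
    then obtain B w where B: "coalition A B" and w: "w \<in> ?V B" and gt: "\<forall>b\<in>B. the (w b) > the (u b)"
      unfolding blocks_def by blast
    show "\<exists>p\<in>X. \<forall>b\<in>fst p. the (snd p b) > the (u b)"
    proof (cases "B = A")
      case True
      then have "(B, w) \<in> X" using w by (simp add: possibility_set_def X_def)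
      then show ?thesis by (rule bexI[rotated]) (simp add: gt)
    next
      case False
      then have "w \<in> derived W B" using w by (simp add: possibility_set_def)
      then obtain ps where ps: "w = foldr (++) (map snd ps) Map.empty" "ps \<noteq> []" "set ps \<subseteq> W"
        "\<Union> (fst ` set ps) = B"
        unfolding derived_def mem_Collect_eq by (elim exE conjE)
      \<comment> \<open>The last block is taken, because its values survive the concatenation by
        \<open>foldr_map_add_last\<close>.\<close>
      obtain qs p where "ps = qs @ [p]" using ps(2) by (cases ps rule: rev_cases) auto
      then obtain C m where qs: "ps = qs @ [(C, m)]" by (cases p) simp
      then have CW: "(C, m) \<in> W" "C \<subseteq> B" using ps(3,4) by auto
      have "w b = m b" if "b \<in> C" for b
        using foldr_map_add_last[of b m] that W[OF CW(1)] by (simp add: ps(1) qs)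
      then have "\<forall>b\<in>C. the (m b) > the (u b)" using gt CW(2) by (metis subsetD)
      moreover have "(C, m) \<in> X" using CW(1) by (simp add: X_def)
      ultimately show ?thesis by (intro bexI[of _ "(C, m)"]) simp_all
    qed
  next
    assume "\<exists>p\<in>X. \<forall>b\<in>fst p. the (snd p b) > the (u b)"
    then obtain p where p: "p \<in> X" and gt: "\<forall>b\<in>fst p. the (snd p b) > the (u b)"
      by (rule bexE)
    obtain B w where Bw: "p = (B, w)" by (cases p)
    have "w \<in> ?V B \<and> coalition A B"
    proof (cases "p \<in> W")
      case True
      then show ?thesis using pair[of B w] W(1)[of B w] by (simp add: Bw)
    next
      case False
      then have "B = A" "w \<in> VA" using p by (auto simp: X_def Bw)
      then show ?thesis using A by (simp add: possibility_set_def)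
    qed
    then show "\<exists>B. coalition A B \<and> blocks ?V B u" using gt unfolding blocks_def Bw by auto
  qed
  then have core: "core A ?V = {u \<in> VA. \<forall>p\<in>X. \<exists>b\<in>fst p. the (snd p b) \<le> the (u b)}"
    by (simp add: core_def possibility_set_def not_less)
  have "{u \<in> VA. Q u} \<noteq> {} \<longleftrightarrow> (\<exists>u\<in>VA. Q u)" for Q by blast
  then show ?thesis unfolding core X_def[symmetric] .
qed

text \<open>No componentwise order: one player of \<open>w\<close> with at least as much in
  \<open>u\<close> suffices, which says that \<open>w\<close> does not block
  \<open>u\<close>.\<close>

definition dominates :: "listing \<Rightarrow> listing \<Rightarrow> bool" where
  "dominates u w \<longleftrightarrow> (\<exists>(b, r)\<in>set w. \<exists>(b', r')\<in>set u. b = b' \<and> r \<le> r')"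

text \<open>Distinct names make \<open>map_of\<close> agree with membership in the list. By
  \<open>sub\<close> each player of \<open>w\<close> has an entry in \<open>u\<close>, so
  \<open>the\<close> is never applied to \<open>None\<close>.\<close>

lemma dominates_iff:
  assumes w: "distinct (map fst w)" and u: "distinct (map fst u)" and sub: "fst ` set w \<subseteq> fst ` set u"
  shows "dominates u w \<longleftrightarrow> (\<exists>b\<in>fst ` set w. the (map_of w b) \<le> the (map_of u b))"
proof -
  have eq: "(\<exists>p'\<in>set u. fst p = fst p' \<and> snd p \<le> snd p') \<longleftrightarrow>
      the (map_of w (fst p)) \<le> the (map_of u (fst p))" if p: "p \<in> set w" for p
  proof -
    obtain b r where br: "p = (b, r)" by (cases p)
    have "b \<in> fst ` set u" using sub p br by force
    then obtain r' where r': "(b, r') \<in> set u" by auto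
    have "map_of u b = Some r'" "map_of w b = Some r" using u w p r' br by simp_all
    moreover have "(\<exists>p'\<in>set u. b = fst p' \<and> r \<le> snd p') \<longleftrightarrow> r \<le> r'"
    proof
      assume "\<exists>p'\<in>set u. b = fst p' \<and> r \<le> snd p'"
      then obtain s where "(b, s) \<in> set u" "r \<le> s" by auto
      then show "r \<le> r'" using eq_key_imp_eq_value[OF u r'] by simp
    next
      assume "r \<le> r'"
      then show "\<exists>p'\<in>set u. b = fst p' \<and> r \<le> snd p'" by (intro bexI[OF _ r']) simp
    qed
    ultimately show ?thesis by (simp add: br)
  qed
  have "dominates u w \<longleftrightarrow> (\<exists>p\<in>set w. \<exists>p'\<in>set u. fst p = fst p' \<and> snd p \<le> snd p')"
    by (simp add: dominates_def case_prod_unfold)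
  also have "\<dots> \<longleftrightarrow> (\<exists>p\<in>set w. the (map_of w (fst p)) \<le> the (map_of u (fst p)))"
    by (rule bex_cong[OF refl eq])
  finally show ?thesis by simp
qed

lemma input_core_nonempty_iff:
  assumes valid: "valid_input (as, ws, vs)"
  shows "input_core (as, ws, vs) \<noteq> {} \<longleftrightarrow> (\<exists>u\<in>set vs. \<forall>w\<in>set (ws @ vs). dominates u w)"
proof -
  let ?A = "set as" and ?W = "(\<lambda>w. (fst ` set w, map_of w)) ` set ws" and ?VA = "map_of ` set vs"
  have dist: "\<And>w. w \<in> set ws \<union> set vs \<Longrightarrow> distinct (map fst w)" and game: "valid_game ?A ?W ?VA"
    using valid by (auto simp: valid_input_def input_players_def input_pairs_def input_outcomes_def)
  have W: "fst ` set w \<subseteq> ?A" if "w \<in> set ws" for w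
    using valid_game_pair(1)[OF game, of "fst ` set w" "map_of w"] that by (auto simp: coalition_def)
  have "\<forall>u\<in>?VA. dom u = ?A" using game by (simp add: valid_game_def)
  then have V: "fst ` set v = ?A" if "v \<in> set vs" for v
    using that by (simp add: dom_map_of_conv_image_fst)
  have dom: "dominates u w \<longleftrightarrow> (\<exists>b\<in>fst ` set w. the (map_of w b) \<le> the (map_of u b))"
    if "u \<in> set vs" "w \<in> set ws \<union> set vs" for u w
    using that W V by (intro dominates_iff dist) auto
  have "input_core (as, ws, vs) \<noteq> {} \<longleftrightarrow>
      (\<exists>u\<in>set vs. \<forall>p \<in> ?W \<union> Pair ?A ` ?VA. \<exists>b\<in>fst p. the (snd p b) \<le> the (map_of u b))"
    using core_nonempty_iff[OF game]
    by (simp add: input_core_def input_players_def input_pairs_def input_outcomes_def)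
  \<comment> \<open>An outcome listing names exactly the players of \<open>?A\<close>, so it becomes
    one more listing of the same form as the pairs.\<close>
  also have "\<dots> \<longleftrightarrow> (\<exists>u\<in>set vs. \<forall>w\<in>set ws \<union> set vs. \<exists>b\<in>fst ` set w. the (map_of w b) \<le> the (map_of u b))"
    using V by (simp add: ball_Un del: bex_simps(7))
  also have "\<dots> \<longleftrightarrow> (\<exists>u\<in>set vs. \<forall>w\<in>set (ws @ vs). dominates u w)"
    using dom by simp
  finally show ?thesis .
qed

section \<open>Reading back written numbers and entries\<close>

declare write_nat.simps [simp del]

lemma write_nat_digits: "c \<in> set (write_nat n) \<Longrightarrow> \<exists>b. c = Digit b"
proof (induction n rule: write_nat.induct)
  case (1 n)
  then show ?case using write_nat.simps[of n] by (auto split: if_splits)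
qed

lemma val_write_nat: "val (rev (write_nat n)) = n"
proof (induction n rule: write_nat.induct)
  case (1 n)
  show ?case
  proof (cases "n < 2")
    case True
    then show ?thesis using write_nat.simps[of n] by (cases "n = 0") auto
  next
    case False
    then have "write_nat n = write_nat (n div 2) @ [Digit (odd n)]"
      using write_nat.simps[of n] by simp
    then show ?thesis using 1 False by simp
  qed
qed

lemma write_nat_eq_iff [simp]: "write_nat m = write_nat n \<longleftrightarrow> m = n"
  by (metis val_write_nat)

lemma write_nat_nonempty: "write_nat n \<noteq> []"
  using write_nat.simps[of n] by auto

lemma until:
  assumes "d \<notin> set g"
  shows "takeWhile (\<lambda>c. c \<noteq> d) (g @ d # xs) = g" "dropWhile (\<lambda>c. c \<noteq> d) (g @ d # xs) = d # xs"
    "takeWhile (\<lambda>c. c \<noteq> d) g = g" "dropWhile (\<lambda>c. c \<noteq> d) g = []"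
  using assms by (induction g) auto

lemma write_nat_until:
  assumes "\<And>b. d \<noteq> Digit b"
  shows "takeWhile (\<lambda>c. c \<noteq> d) (write_nat n @ d # xs) = write_nat n"
    "dropWhile (\<lambda>c. c \<noteq> d) (write_nat n @ d # xs) = d # xs"
    "takeWhile (\<lambda>c. c \<noteq> d) (write_nat n) = write_nat n"
proof -
  have "d \<notin> set (write_nat n)" using write_nat_digits assms by blast
  then show "takeWhile (\<lambda>c. c \<noteq> d) (write_nat n @ d # xs) = write_nat n"
    "dropWhile (\<lambda>c. c \<noteq> d) (write_nat n @ d # xs) = d # xs"
    "takeWhile (\<lambda>c. c \<noteq> d) (write_nat n) = write_nat n"
    using until[of d "write_nat n"] by simp_all
qed

definition write_entry :: "nat \<times> rat \<Rightarrow> letter list" where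
  "write_entry = (\<lambda>(b, r). write_nat b @ [Colon] @ write_rat r)"

lemma write_entry_parts:
  assumes "quotient_of r = (p, q)"
  shows "key (write_entry (b, r)) = write_nat b" "negative (write_entry (b, r)) \<longleftrightarrow> p < 0"
    "numer (write_entry (b, r)) = write_nat (nat \<bar>p\<bar>)"
    "denom (write_entry (b, r)) = write_nat (nat q)"
proof -
  let ?e = "write_entry (b, r)"
  show "key ?e = write_nat b" by (simp add: key_def write_entry_def write_nat_until)
  have a: "amount ?e = (if p < 0 then [Minus] else []) @ write_nat (nat \<bar>p\<bar>) @ Slash # write_nat (nat q)"
    by (simp add: amount_def write_entry_def write_nat_until write_rat_def write_int_def assms)
  \<comment> \<open>A written numeral is nonempty and starts with a digit, so a leading
    \<open>Minus\<close> can only be the sign.\<close>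
  show neg: "negative ?e \<longleftrightarrow> p < 0"
  proof (cases "write_nat (nat \<bar>p\<bar>)")
    case (Cons c cs)
    then obtain d where "c = Digit d" using write_nat_digits[of c "nat \<bar>p\<bar>"] by auto
    then show ?thesis using Cons a by (simp add: negative_def)
  qed (simp add: write_nat_nonempty)
  have m: "magnitude ?e = write_nat (nat \<bar>p\<bar>) @ Slash # write_nat (nat q)"
    using neg a by (simp add: magnitude_def)
  show "numer ?e = write_nat (nat \<bar>p\<bar>)" "denom ?e = write_nat (nat q)"
    by (simp_all add: numer_def denom_def m write_nat_until)
qed

text \<open>\<open>quotient_of\<close> has a positive denominator, so \<open>r \<le> r'\<close> is
  \<open>p * q' \<le> p' * q\<close>. The program knows only the absolute values of both sides: if
  exactly one of \<open>p\<close> and \<open>p'\<close> is negative, the sign decides, and if both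
  are, the order of the absolute values is reversed.\<close>

lemma le_entry_write_entry: "le_entry (write_entry (b, r)) (write_entry (b', r')) \<longleftrightarrow> b = b' \<and> r \<le> r'"
proof -
  obtain p q where q: "quotient_of r = (p, q)" by fastforce
  obtain p' q' where q': "quotient_of r' = (p', q')" by fastforce
  have pos: "q > 0" "q' > 0" using q q' quotient_of_denom_pos by blast+
  have le: "r \<le> r' \<longleftrightarrow> p * q' \<le> p' * q" by (simp add: rat_less_eq_code q q' Let_def mult.commute)
  have ne: "write_entry (b, r) \<noteq> []" by (simp add: write_entry_def)
  let ?a = "nat \<bar>p\<bar> * nat q'" and ?b = "nat \<bar>p'\<bar> * nat q"
  have ab: "int ?a = \<bar>p\<bar> * q'" "int ?b = \<bar>p'\<bar> * q" using pos by simp_all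
  have "(if p' < 0 then p < 0 \<and> ?b \<le> ?a else p < 0 \<or> ?a \<le> ?b) \<longleftrightarrow> p * q' \<le> p' * q"
  proof (cases "p' < 0")
    case True
    then have neg: "p' * q < 0" using pos by (simp add: mult_neg_pos)
    show ?thesis
    proof (cases "p < 0")
      case p: True
      have "?b \<le> ?a \<longleftrightarrow> int ?b \<le> int ?a" by linarith
      then show ?thesis unfolding ab using True p by simp
    next
      case False
      then have "p * q' \<ge> 0" using pos by simp
      then have "\<not> p * q' \<le> p' * q" using neg by linarith
      then show ?thesis using True False by simp
    qed
  next
    case False
    then have nn: "p' * q \<ge> 0" using pos by simp
    show ?thesis
    proof (cases "p < 0")
      case True
      then have "p * q' < 0" using pos by (simp add: mult_neg_pos)
      then have "p * q' \<le> p' * q" using nn by linarith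
      then show ?thesis using True False by simp
    next
      case p: False
      have "?a \<le> ?b \<longleftrightarrow> int ?a \<le> int ?b" by linarith
      then show ?thesis unfolding ab using False p by simp
    qed
  qed
  then show ?thesis
    unfolding le_entry_def write_entry_parts[OF q] write_entry_parts[OF q'] val_write_nat Let_def
    by (simp only: ne le write_nat_eq_iff simp_thms)
qed

section \<open>Segments of written text\<close>

lemma segs_append: "d \<notin> set g \<Longrightarrow> segs d (g @ d # xs) = g # segs d xs"
proof (cases g)
  case Nil
  then show ?thesis by simp
next
  case (Cons x ys)
  assume "d \<notin> set g"
  from until(1,2)[OF this] show ?thesis using Cons by simp
qed

lemma segs_single:
  assumes "d \<notin> set g" "g \<noteq> []"
  shows "segs d g = [g]"
proof -
  obtain x ys where "g = x # ys" using assms(2) by (cases g) auto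
  then have "segs d g = takeWhile (\<lambda>c. c \<noteq> d) g # segs d (tl (dropWhile (\<lambda>c. c \<noteq> d) g))"
    by (simp only: segs.simps)
  then show ?thesis using until(3,4)[OF assms(1)] by simp
qed

lemma segs_terminated:
  "(\<And>x. x \<in> set xs \<Longrightarrow> d \<notin> set (f x)) \<Longrightarrow> segs d (concat (map (\<lambda>x. f x @ [d]) xs)) = map f xs"
  by (induction xs) (auto simp: segs_append)

text \<open>Meant for reversed text, where separators precede the items. The last item has no
  terminator, so it is found only when nonempty.\<close>

lemma segs_preceded:
  assumes "d \<notin> set g" "g \<noteq> []" "\<And>x. x \<in> set xs \<Longrightarrow> d \<notin> set (f x) \<and> f x \<noteq> []"
  shows "segs d (g @ concat (map (\<lambda>x. d # f x) xs)) = g # map f xs"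
  using assms
proof (induction xs arbitrary: g)
  case Nil
  then show ?case by (simp add: segs_single)
next
  case (Cons x xs)
  then show ?case using segs_append[of d g "f x @ concat (map (\<lambda>x. d # f x) xs)"] by simp
qed

lemma write_entry_letters:
  "Comma \<notin> set (write_entry e)" "Semicolon \<notin> set (write_entry e)" "Bar \<notin> set (write_entry e)"
  by (auto simp: write_entry_def write_rat_def write_int_def split: prod.splits if_splits
      dest: write_nat_digits)

lemma write_entry_nonempty: "write_entry e \<noteq> []"
  by (simp add: write_entry_def split: prod.split)

definition write_entries :: "listing \<Rightarrow> letter list" where
  "write_entries w = concat (map (\<lambda>e. write_entry e @ [Comma]) w)"

lemma write_listing_entries: "write_listing w = write_entries w @ [Semicolon]"
  by (simp add: write_listing_def write_entries_def write_entry_def case_prod_unfold)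

text \<open>Reversing a listing turns the final comma into the first letter, whence the empty segment.\<close>

lemma segs_rev_entries:
  "segs Comma (rev (write_entries w)) =
     (if w = [] then [] else [] # map (\<lambda>e. rev (write_entry e)) (rev w))"
proof (cases w rule: rev_cases)
  case Nil
  then show ?thesis by (simp add: write_entries_def)
next
  case (snoc v e)
  have "rev (write_entries v) = concat (map (\<lambda>e. Comma # rev (write_entry e)) (rev v))" for v
    by (induction v) (auto simp: write_entries_def)
  then have "rev (write_entries w) =
      [] @ Comma # (rev (write_entry e) @ concat (map (\<lambda>e. Comma # rev (write_entry e)) (rev v)))"
    using snoc by simp
  then show ?thesis
    using snoc segs_append[of Comma "[]"] write_entry_letters write_entry_nonempty
    by (simp add: segs_preceded del: segs.simps append_Nil)
qed

text \<open>The empty segments of the reversed listings must not match: on the side of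
  \<open>w\<close> the condition \<open>e \<noteq> []\<close> rejects them, on the side of
  \<open>u\<close> their empty key differs from every written player.\<close>

lemma meets_entries: "meets (rev (write_entries w)) (rev (write_entries u)) \<longleftrightarrow> dominates u w"
proof -
  have nil: "\<not> le_entry [] e" for e by (simp add: le_entry_def)
  have nil': "\<not> le_entry (write_entry e) []" for e
    by (cases e; cases "quotient_of (snd e)")
       (auto simp: le_entry_def write_entry_parts write_nat_nonempty, auto simp: key_def write_nat_nonempty)
  have le: "le_entry (write_entry e) (write_entry e') \<longleftrightarrow> fst e = fst e' \<and> snd e \<le> snd e'" for e e'
    using le_entry_write_entry[of "fst e" "snd e" "fst e'" "snd e'"] by simp
  have segs: "rev ` set (segs Comma (rev (write_entries v))) =
      (if v = [] then {} else insert [] (write_entry ` set v))" for v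
    by (auto simp: segs_rev_entries image_image)
  have meets: "meets (rev (write_entries w)) (rev (write_entries u)) \<longleftrightarrow>
      (\<exists>s\<in>rev ` set (segs Comma (rev (write_entries w))).
        \<exists>s'\<in>rev ` set (segs Comma (rev (write_entries u))). le_entry s s')"
    by (simp add: meets_def)
  have "meets (rev (write_entries w)) (rev (write_entries u)) \<longleftrightarrow>
      (\<exists>e\<in>set w. \<exists>e'\<in>set u. le_entry (write_entry e) (write_entry e'))"
    unfolding meets segs by (cases "w = []"; cases "u = []") (simp_all add: nil nil')
  then show ?thesis by (simp add: le dominates_def case_prod_unfold)
qed

text \<open>Listings contain no \<open>Bar\<close>, so cutting backwards at the bars isolates the
  outcomes and the pairs.\<close>

lemma accepts_write_input:
  "accepts (write_input (as, ws, vs)) \<longleftrightarrow> (\<exists>u\<in>set vs. \<forall>w\<in>set (ws @ vs). dominates u w)"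
proof -
  let ?A = "concat (map (\<lambda>a. write_nat a @ [Comma]) as)"
  let ?ws = "concat (map write_listing ws)" and ?vs = "concat (map write_listing vs)"
  have bar: "Bar \<notin> set (concat (map write_listing us))" for us
    by (auto simp: write_listing_entries write_entries_def write_entry_letters)
  then have "Bar \<notin> set (rev (concat (map write_listing us)))" for us
    using bar[of us] by simp
  note until = until(1,2)[OF this]
  have rev: "rev (write_input (as, ws, vs)) = rev ?vs @ Bar # (rev ?ws @ Bar # rev ?A)"
    by (simp add: write_input_def)
  have vs: "outcomes_text (write_input (as, ws, vs)) = ?vs"
    unfolding outcomes_text_def rev until by simp
  have ws: "offers_text (write_input (as, ws, vs)) = concat (map write_listing (ws @ vs))"
    unfolding offers_text_def vs unfolding rev until list.sel by simp
  have segs: "segs Semicolon (concat (map write_listing us)) = map write_entries us" for us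
  proof -
    have listing: "write_listing = (\<lambda>w. write_entries w @ [Semicolon])"
      by (rule ext) (rule write_listing_entries)
    show ?thesis unfolding listing
      by (rule segs_terminated) (auto simp: write_entries_def write_entry_letters)
  qed
  show ?thesis unfolding accepts_def vs ws segs by (simp add: meets_entries ball_Un)
qed

lemma accepts_encode:
  assumes "valid_input I"
  shows "accepts (decode (map Digit (encode I))) \<longleftrightarrow> input_core I \<noteq> {}"
proof -
  obtain as ws vs where I: "I = (as, ws, vs)" by (cases I)
  show ?thesis
    using assms unfolding I encode_def decode_encode by (simp only: accepts_write_input input_core_nonempty_iff)
qed

theorem theorem3: "core_nonempty_problem \<in> class_P"
proof -
  obtain M and P :: "nat poly" where M: "turing_machine M"
    "\<And>x. state_after M x (poly P (length x)) =
      (if accepts (decode (map Digit x)) then accept M else reject M)"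
    using accepts_decidable by blast
  have answer: "state_after M (encode I) (poly P (length (encode I))) =
      (if input_core I \<noteq> {} then accept M else reject M)" if "valid_input I" for I
    using M(2)[of "encode I"] accepts_encode[OF that] by simp
  \<comment> \<open>\<open>M(2)\<close> holds for every string, so the machine also halts where the
    promise is broken.\<close>
  have halt: "\<forall>x. state_after M x (poly P (length x)) \<in> {accept M, reject M}"
    by (simp add: M(2))
  have yes: "\<forall>x\<in>{encode I | I. valid_input I \<and> input_core I \<noteq> {}}.
      state_after M x (poly P (length x)) = accept M"
  proof
    fix x assume "x \<in> {encode I | I. valid_input I \<and> input_core I \<noteq> {}}"
    then obtain I where "x = encode I" "valid_input I" "input_core I \<noteq> {}"
      unfolding mem_Collect_eq by (elim exE conjE)
    then show "state_after M x (poly P (length x)) = accept M" using answer[of I] by simp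
  qed
  have no: "\<forall>x\<in>{encode I | I. valid_input I \<and> input_core I = {}}.
      state_after M x (poly P (length x)) = reject M"
  proof
    fix x assume "x \<in> {encode I | I. valid_input I \<and> input_core I = {}}"
    then obtain I where "x = encode I" "valid_input I" "input_core I = {}"
      unfolding mem_Collect_eq by (elim exE conjE)
    then show "state_after M x (poly P (length x)) = reject M" using answer[of I] by simp
  qed
  show ?thesis
    unfolding core_nonempty_problem_def class_P_def mem_Collect_eq prod.case
    by (intro exI[of _ M] exI[of _ P] conjI M(1) halt yes no)
qed

end
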